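(* Every irreducible quasi-homogeneous polynomial $p\in\mathbb{C}[x,y]$ has a strong tensor-splitting property. Specifically, suppose $p\in\mathbb{C}[x,y]$ is irreducible and $p(x,y)=A(x^\alpha y^\beta-B)$ or $p(x,y)=A(Bx^\alpha-y^\beta)$ for some coprime positive integers $\alpha,\beta$ and constants $A,B\in\mathbb{C}$, and let $\eta\in\mathbb{C}$ be such that $\eta^\beta=B$. Let $A_1,A_2$ be $\mathbb{C}$-algebras and let $S_i,T_i\in A_i$ (not both zero), $i=1,2$, and let $n$ be a positive integer. If $$\Phi(p^n)(S_1\otimes S_2,T_1\otimes T_2)=0 \quad\text{in } A_1\otimes A_2$$ and $S_i$ is left-invertible and $T_i$ is right-invertible for $i=1,2$, then there exist $\lambda\in\mathbb{C}^\ast$ and integers $l,m\ge 0$ with $l+m\le n+1$ such that $$\Phi(p_\lambda^l)(S_1,T_1)=0,\qquad \Phi(p_{\eta/\lambda}^m)(S_2,T_2)=0.$$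
   Context: A $\mathbb{C}$-algebra means an associative (possibly noncommutative) $\mathbb{C}$-algebra with identity; $\mathbb{C}^\ast=\mathbb{C}\setminus\{0\}$. $\Phi:\mathbb{C}[x,y]\to\mathbb{C}\langle X,Y\rangle$ is the linear map from commutative polynomials to noncommutative polynomials with $\Phi(x^iy^j)=X^iY^j$. For $\omega\in\mathbb{C}\langle X,Y\rangle$ and $S,T$ in a $\mathbb{C}$-algebra, $\omega(S,T)$ is the image of $\omega$ under the unital algebra homomorphism $X\mapsto S$, $Y\mapsto T$. Notation: $p_{a,b}(x,y)=p(ax,by)$ and $p_\lambda(x,y)=p(x,\lambda y)$ for $a,b,\lambda\in\mathbb{C}$. A polynomial $p(x,y)=\sum k_{ij}x^iy^j$ is quasi-homogeneous if there exist coprime integers $w_1,w_2$ (not required to be positive) and an integer $d$ such that $k_{ij}\ne0$ implies $w_1i+w_2j=d$; equivalently $p(\lambda^{w_1}x,\lambda^{w_2}y)=\lambda^dp(x,y)$ for all $\lambda\in\mathbb{C}^\ast$. $p$ has a weak tensor-splitting property if for all $\mathbb{C}$-algebras $A_1,A_2$, all $S_i,T_i\in A_i$ (not both zero, for each $i=1,2$) and all positive integers $n$: if $\Phi(p^n)(S_1\otimes S_2,T_1\otimes T_2)=0$ in $A_1\otimes A_2$, then there exist $a,b,c,d\in\mathbb{C}$ with $\Phi(p_{a,b}^l)(S_1,T_1)=0$ and $\Phi(p_{c,d}^m)(S_2,T_2)=0$ for large enough $l,m$. $p$ has a strong tensor-splitting property if additionally "large enough $l,m$" can be replaced by "some positive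 $l,m$ with $l+m=n+1$" whenever $S_i$ is left-invertible and $T_i$ is right-invertible for $i=1,2$. *)

theory Defs
  imports "HOL-Computational_Algebra.Computational_Algebra" "HOL-Library.Poly_Mapping"
begin

section \<open>Complex algebras\<close>

text \<open>Associative unital algebras over the complex numbers, not necessarily commutative.
  The class \<open>ring_1\<close> is avoided because it would exclude the zero algebra.\<close>

class complex_algebra_1 = ring + monoid_mult +
  fixes scaleC :: "complex \<Rightarrow> 'a \<Rightarrow> 'a" (infixr \<open>*\<^sub>C\<close> 75)
  assumes scaleC_add_right: "c *\<^sub>C (x + y) = c *\<^sub>C x + c *\<^sub>C y"
    and scaleC_add_left: "(c + d) *\<^sub>C x = c *\<^sub>C x + d *\<^sub>C x"
    and scaleC_scaleC: "c *\<^sub>C (d *\<^sub>C x) = (c * d) *\<^sub>C x"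
    and scaleC_one: "1 *\<^sub>C x = x"
    and mult_scaleC_left: "(c *\<^sub>C x) * y = c *\<^sub>C (x * y)"
    and mult_scaleC_right: "x * (c *\<^sub>C y) = c *\<^sub>C (x * y)"

lemma scaleC_zero_left [simp]: "0 *\<^sub>C x = (0 :: 'a :: complex_algebra_1)"
  using scaleC_add_left[of 0 0 x] by simp

lemma scaleC_zero_right [simp]: "c *\<^sub>C 0 = (0 :: 'a :: complex_algebra_1)"
  using scaleC_add_right[of c 0 0] by simp

definition left_invertible :: "'a :: monoid_mult \<Rightarrow> bool" where
  "left_invertible S \<longleftrightarrow> (\<exists>L. L * S = 1)"

definition right_invertible :: "'a :: monoid_mult \<Rightarrow> bool" where
  "right_invertible T \<longleftrightarrow> (\<exists>R. T * R = 1)"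


section \<open>Tensor products of complex algebras\<close>

text \<open>\<open>A \<otimes> B\<close> is the vector space with basis the formal symbols \<open>TGen a b\<close>, for \<open>a\<close> in \<open>A\<close>
  and \<open>b\<close> in \<open>B\<close>, divided by the span of the bilinearity relations. The product of symbols
  is \<open>(a, b) (a', b') = (a a', b b')\<close>. As \<^typ>\<open>'k \<Rightarrow>\<^sub>0 'c\<close> is the monoid algebra of an
  additively written monoid, this product has to be called \<open>+\<close>, with unit \<open>0\<close>; the
  multiplication of \<open>('a, 'b) tgen \<Rightarrow>\<^sub>0 complex\<close> is then its bilinear extension.\<close>

datatype ('a, 'b) tgen = TGen 'a 'b

instantiation tgen :: (monoid_mult, monoid_mult) monoid_add
begin
definition zero_tgen :: "('a, 'b) tgen" where "0 = TGen 1 1"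
fun plus_tgen :: "('a, 'b) tgen \<Rightarrow> ('a, 'b) tgen \<Rightarrow> ('a, 'b) tgen" where
  "TGen a b + TGen a' b' = TGen (a * a') (b * b')"
instance
proof
  fix x y z :: "('a, 'b) tgen"
  show "x + y + z = x + (y + z)" by (cases x; cases y; cases z) (simp add: mult.assoc)
  show "0 + x = x" "x + 0 = x" by (cases x; simp add: zero_tgen_def)+
qed
end

definition fv_scale :: "complex \<Rightarrow> ('k \<Rightarrow>\<^sub>0 complex) \<Rightarrow> ('k \<Rightarrow>\<^sub>0 complex)" where
  "fv_scale c = Poly_Mapping.map ((*) c)"

lemma lookup_fv_scale [simp]: "Poly_Mapping.lookup (fv_scale c f) k = c * Poly_Mapping.lookup f k"
  by (simp add: fv_scale_def Poly_Mapping.map.rep_eq when_def)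

global_interpretation fv: vector_space "fv_scale :: complex \<Rightarrow> ('k \<Rightarrow>\<^sub>0 complex) \<Rightarrow> _"
  by unfold_locales (auto intro!: poly_mapping_eqI simp: lookup_add algebra_simps)

definition tensor_relations ::
  "(('a :: complex_algebra_1, 'b :: complex_algebra_1) tgen \<Rightarrow>\<^sub>0 complex) set" where
  "tensor_relations =
     {Poly_Mapping.single (TGen (a + a') b) 1 - Poly_Mapping.single (TGen a b) 1
        - Poly_Mapping.single (TGen a' b) 1 | a a' b. True} \<union>
     {Poly_Mapping.single (TGen a (b + b')) 1 - Poly_Mapping.single (TGen a b) 1
        - Poly_Mapping.single (TGen a b') 1 | a b b'. True} \<union>
     {Poly_Mapping.single (TGen (c *\<^sub>C a) b) 1
        - fv_scale c (Poly_Mapping.single (TGen a b) 1) | c a b. True} \<union>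
     {Poly_Mapping.single (TGen a (c *\<^sub>C b)) 1
        - fv_scale c (Poly_Mapping.single (TGen a b) 1) | c a b. True}"

definition tensor_null ::
  "(('a :: complex_algebra_1, 'b :: complex_algebra_1) tgen \<Rightarrow>\<^sub>0 complex) set" where
  "tensor_null = module.span fv_scale tensor_relations"

lemma fv_scale_conv_mult: "fv_scale c f = Poly_Mapping.single 0 c * f"
  for f :: "'k :: monoid_add \<Rightarrow>\<^sub>0 complex"
  unfolding fv_scale_def by (rule mult_map_scale_conv_mult)

lemma fv_scale_mult_left: "fv_scale c f * g = fv_scale c (f * g)"
  for f :: "'k :: monoid_add \<Rightarrow>\<^sub>0 complex"
  by (simp add: fv_scale_conv_mult mult.assoc)

lemma fv_scale_single: "fv_scale c (Poly_Mapping.single k z) = Poly_Mapping.single k (c * z)"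
  by (rule poly_mapping_eqI) (simp add: lookup_single when_def)

lemma pm_induct [case_names single sum]:
  fixes f :: "'k \<Rightarrow>\<^sub>0 'c :: comm_monoid_add"
  assumes single: "\<And>k z. P (Poly_Mapping.single k z)"
    and sum: "\<And>f g. P f \<Longrightarrow> P g \<Longrightarrow> P (f + g)"
  shows "P f"
proof (induction f rule: update_induct)
  case const
  show ?case using single[of undefined 0] by simp
next
  case (update f a b)
  have "Poly_Mapping.update a b f = f + Poly_Mapping.single a b"
    using update.hyps
    by (intro poly_mapping_eqI) (auto simp: lookup_update lookup_add lookup_single when_def in_keys_iff)
  then show ?case using sum[OF update.IH single] by simp
qed

lemma single_central: "Poly_Mapping.single 0 c * f = f * Poly_Mapping.single 0 (c :: complex)"
  for f :: "'k :: monoid_add \<Rightarrow>\<^sub>0 complex"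
  by (induction f rule: pm_induct) (simp_all add: mult_single algebra_simps)

lemma fv_scale_mult_right: "f * fv_scale c g = fv_scale c (f * g)"
  for f :: "'k :: monoid_add \<Rightarrow>\<^sub>0 complex"
  unfolding fv_scale_conv_mult by (metis single_central mult.assoc)

lemma single_mult_tensor_relation:
  assumes "r \<in> tensor_relations"
  shows "Poly_Mapping.single k 1 * r \<in> tensor_relations"
    and "r * Poly_Mapping.single k 1 \<in> tensor_relations"
proof -
  obtain p q where k: "k = TGen p q" by (cases k)
  show "Poly_Mapping.single k 1 * r \<in> tensor_relations"
    using assms unfolding tensor_relations_def k
    by (elim UnE; clarsimp simp: right_diff_distrib mult_single fv_scale_single distrib_left
        mult_scaleC_right; blast)
  show "r * Poly_Mapping.single k 1 \<in> tensor_relations"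
    using assms unfolding tensor_relations_def k
    by (elim UnE; clarsimp simp: left_diff_distrib mult_single fv_scale_single distrib_right
        mult_scaleC_left; blast)
qed

lemma tensor_null_mult:
  assumes "r \<in> tensor_null"
  shows "f * r \<in> tensor_null" and "r * f \<in> tensor_null"
proof -
  have 1: "Poly_Mapping.single k z * r \<in> tensor_null" for k z
  proof -
    have "Poly_Mapping.single k 1 * r \<in> tensor_null"
      using assms unfolding tensor_null_def
    proof (induction rule: fv.span_induct_alt)
      case base
      show ?case by (simp add: fv.span_zero)
    next
      case (step c x y)
      then show ?case
        unfolding distrib_left fv_scale_mult_right
        by (blast intro: fv.span_add fv.span_scale fv.span_base single_mult_tensor_relation(1))
    qed
    then have "fv_scale z (Poly_Mapping.single k 1 * r) \<in> tensor_null"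
      unfolding tensor_null_def by (rule fv.span_scale)
    then show ?thesis by (simp add: fv_scale_mult_left[symmetric] fv_scale_single)
  qed
  have 2: "r * Poly_Mapping.single k z \<in> tensor_null" for k z
  proof -
    have "r * Poly_Mapping.single k 1 \<in> tensor_null"
      using assms unfolding tensor_null_def
    proof (induction rule: fv.span_induct_alt)
      case base
      show ?case by (simp add: fv.span_zero)
    next
      case (step c x y)
      then show ?case
        unfolding distrib_right fv_scale_mult_left
        by (blast intro: fv.span_add fv.span_scale fv.span_base single_mult_tensor_relation(2))
    qed
    then have "fv_scale z (r * Poly_Mapping.single k 1) \<in> tensor_null"
      unfolding tensor_null_def by (rule fv.span_scale)
    then show ?thesis by (simp add: fv_scale_mult_right[symmetric] fv_scale_single)
  qed
  show "f * r \<in> tensor_null"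
    by (induction f rule: pm_induct)
       (use 1 in \<open>auto simp: distrib_right tensor_null_def intro: fv.span_add\<close>)
  show "r * f \<in> tensor_null"
    by (induction f rule: pm_induct)
       (use 2 in \<open>auto simp: distrib_left tensor_null_def intro: fv.span_add\<close>)
qed

quotient_type (overloaded) ('a, 'b) tensor = "('a :: complex_algebra_1, 'b :: complex_algebra_1) tgen \<Rightarrow>\<^sub>0 complex"
  / "\<lambda>f g. f - g \<in> tensor_null"
proof (rule equivpI)
  show "reflp (\<lambda>f g :: ('a, 'b) tgen \<Rightarrow>\<^sub>0 complex. f - g \<in> tensor_null)"
    by (simp add: reflp_def tensor_null_def fv.span_zero)
  show "symp (\<lambda>f g :: ('a, 'b) tgen \<Rightarrow>\<^sub>0 complex. f - g \<in> tensor_null)"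
  proof (rule sympI)
    fix f g :: "('a, 'b) tgen \<Rightarrow>\<^sub>0 complex"
    assume "f - g \<in> tensor_null"
    then have "- (f - g) \<in> tensor_null" unfolding tensor_null_def by (rule fv.span_neg)
    then show "g - f \<in> tensor_null" by simp
  qed
  show "transp (\<lambda>f g :: ('a, 'b) tgen \<Rightarrow>\<^sub>0 complex. f - g \<in> tensor_null)"
  proof (rule transpI)
    fix f g h :: "('a, 'b) tgen \<Rightarrow>\<^sub>0 complex"
    assume "f - g \<in> tensor_null" "g - h \<in> tensor_null"
    then have "(f - g) + (g - h) \<in> tensor_null" unfolding tensor_null_def by (rule fv.span_add)
    then show "f - h \<in> tensor_null" by simp
  qed
qed

lift_definition pure_tensor ::
  "'a :: complex_algebra_1 \<Rightarrow> 'b :: complex_algebra_1 \<Rightarrow> ('a, 'b) tensor" (infixr \<open>\<otimes>\<^sub>C\<close> 72)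
  is "\<lambda>a b. Poly_Mapping.single (TGen a b) 1" .

instantiation tensor :: (complex_algebra_1, complex_algebra_1) complex_algebra_1
begin

lift_definition zero_tensor :: "('a, 'b) tensor" is 0 .

lift_definition one_tensor :: "('a, 'b) tensor" is 1 .

lift_definition plus_tensor :: "('a, 'b) tensor \<Rightarrow> ('a, 'b) tensor \<Rightarrow> ('a, 'b) tensor" is "(+)"
proof -
  fix f f' g g' :: "('a, 'b) tgen \<Rightarrow>\<^sub>0 complex"
  assume "f - f' \<in> tensor_null" "g - g' \<in> tensor_null"
  then have "(f - f') + (g - g') \<in> tensor_null" unfolding tensor_null_def by (rule fv.span_add)
  then show "(f + g) - (f' + g') \<in> tensor_null" by (simp add: algebra_simps)
qed

lift_definition uminus_tensor :: "('a, 'b) tensor \<Rightarrow> ('a, 'b) tensor" is uminus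
proof -
  fix f f' :: "('a, 'b) tgen \<Rightarrow>\<^sub>0 complex"
  assume "f - f' \<in> tensor_null"
  then have "- (f - f') \<in> tensor_null" unfolding tensor_null_def by (rule fv.span_neg)
  then show "- f - - f' \<in> tensor_null" by simp
qed

lift_definition minus_tensor :: "('a, 'b) tensor \<Rightarrow> ('a, 'b) tensor \<Rightarrow> ('a, 'b) tensor" is "(-)"
proof -
  fix f f' g g' :: "('a, 'b) tgen \<Rightarrow>\<^sub>0 complex"
  assume "f - f' \<in> tensor_null" "g - g' \<in> tensor_null"
  then have "(f - f') - (g - g') \<in> tensor_null" unfolding tensor_null_def by (rule fv.span_diff)
  then show "(f - g) - (f' - g') \<in> tensor_null" by (simp add: algebra_simps)
qed

lift_definition times_tensor :: "('a, 'b) tensor \<Rightarrow> ('a, 'b) tensor \<Rightarrow> ('a, 'b) tensor" is "(*)"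
proof -
  fix f f' g g' :: "('a, 'b) tgen \<Rightarrow>\<^sub>0 complex"
  assume "f - f' \<in> tensor_null" "g - g' \<in> tensor_null"
  then have "(f - f') * g \<in> tensor_null" "f' * (g - g') \<in> tensor_null"
    by (simp_all add: tensor_null_mult)
  then have "(f - f') * g + f' * (g - g') \<in> tensor_null"
    unfolding tensor_null_def by (rule fv.span_add)
  then show "f * g - f' * g' \<in> tensor_null" by (simp add: algebra_simps)
qed

lift_definition scaleC_tensor :: "complex \<Rightarrow> ('a, 'b) tensor \<Rightarrow> ('a, 'b) tensor" is fv_scale
proof -
  fix c and f f' :: "('a, 'b) tgen \<Rightarrow>\<^sub>0 complex"
  assume "f - f' \<in> tensor_null"
  then have "fv_scale c (f - f') \<in> tensor_null" unfolding tensor_null_def by (rule fv.span_scale)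
  then show "fv_scale c f - fv_scale c f' \<in> tensor_null" by (simp add: fv.scale_right_diff_distrib)
qed

instance
proof
  have eq: "f = g \<Longrightarrow> f - g \<in> tensor_null" for f g :: "('a, 'b) tgen \<Rightarrow>\<^sub>0 complex"
    by (simp add: tensor_null_def fv.span_zero)
  fix x y z :: "('a, 'b) tensor" and c d :: complex
  show "x + y + z = x + (y + z)" by transfer (rule eq, simp add: algebra_simps)
  show "x + y = y + x" by transfer (rule eq, simp add: algebra_simps)
  show "0 + x = x" by transfer (rule eq, simp)
  show "- x + x = 0" by transfer (rule eq, simp)
  show "x - y = x + - y" by transfer (rule eq, simp)
  show "x * y * z = x * (y * z)" by transfer (rule eq, simp add: mult.assoc)
  show "(x + y) * z = x * z + y * z" by transfer (rule eq, simp add: distrib_right)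
  show "x * (y + z) = x * y + x * z" by transfer (rule eq, simp add: distrib_left)
  show "1 * x = x" by transfer (rule eq, simp)
  show "x * 1 = x" by transfer (rule eq, simp)
  show "c *\<^sub>C (x + y) = c *\<^sub>C x + c *\<^sub>C y"
    by transfer (rule eq, simp add: fv.scale_right_distrib)
  show "(c + d) *\<^sub>C x = c *\<^sub>C x + d *\<^sub>C x"
    by transfer (rule eq, simp add: fv.scale_left_distrib)
  show "c *\<^sub>C (d *\<^sub>C x) = (c * d) *\<^sub>C x" by transfer (rule eq, simp)
  show "1 *\<^sub>C x = x" by transfer (rule eq, simp)
  show "(c *\<^sub>C x) * y = c *\<^sub>C (x * y)" by transfer (rule eq, simp add: fv_scale_mult_left)
  show "x * (c *\<^sub>C y) = c *\<^sub>C (x * y)" by transfer (rule eq, simp add: fv_scale_mult_right)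
qed

end

lemma pure_tensor_mult: "(a \<otimes>\<^sub>C b) * (a' \<otimes>\<^sub>C b') = (a * a') \<otimes>\<^sub>C (b * b')"
  by transfer (simp add: mult_single tensor_null_def fv.span_zero)

lemma one_tensor_eq: "1 = 1 \<otimes>\<^sub>C 1"
  by transfer (simp add: zero_tgen_def[symmetric] tensor_null_def fv.span_zero)

lemma pure_tensor_add_left: "(a + a') \<otimes>\<^sub>C b = a \<otimes>\<^sub>C b + a' \<otimes>\<^sub>C b"
  by transfer (unfold tensor_null_def tensor_relations_def diff_diff_eq[symmetric],
      rule fv.span_base, blast)

lemma pure_tensor_add_right: "a \<otimes>\<^sub>C (b + b') = a \<otimes>\<^sub>C b + a \<otimes>\<^sub>C b'"
  by transfer (unfold tensor_null_def tensor_relations_def diff_diff_eq[symmetric],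
      rule fv.span_base, blast)

lemma pure_tensor_scaleC_left: "(c *\<^sub>C a) \<otimes>\<^sub>C b = c *\<^sub>C (a \<otimes>\<^sub>C b)"
  by transfer (unfold tensor_null_def tensor_relations_def, rule fv.span_base, blast)

lemma pure_tensor_scaleC_right: "a \<otimes>\<^sub>C (c *\<^sub>C b) = c *\<^sub>C (a \<otimes>\<^sub>C b)"
  by transfer (unfold tensor_null_def tensor_relations_def, rule fv.span_base, blast)


section \<open>Noncommutative polynomials in two variables\<close>

text \<open>The free algebra on \<open>X\<close> and \<open>Y\<close> is the monoid algebra of the monoid of words;
  again concatenation of words has to be written \<open>+\<close>.\<close>

datatype nc_letter = LX | LY

datatype nc_word = Word (letters: "nc_letter list")

instantiation nc_word :: monoid_add
begin
definition zero_nc_word :: nc_word where "0 = Word []"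
definition plus_nc_word :: "nc_word \<Rightarrow> nc_word \<Rightarrow> nc_word" where
  "u + v = Word (letters u @ letters v)"
instance by standard (simp_all add: zero_nc_word_def plus_nc_word_def)
end

type_synonym nc_poly = "nc_word \<Rightarrow>\<^sub>0 complex"

definition nc_const :: "complex \<Rightarrow> nc_poly" where "nc_const c = Poly_Mapping.single 0 c"
definition nc_X :: nc_poly where "nc_X = Poly_Mapping.single (Word [LX]) 1"
definition nc_Y :: nc_poly where "nc_Y = Poly_Mapping.single (Word [LY]) 1"

definition word_eval :: "'a :: monoid_mult \<Rightarrow> 'a \<Rightarrow> nc_word \<Rightarrow> 'a" where
  "word_eval S T w = prod_list (map (case_nc_letter S T) (letters w))"

text \<open>\<open>nc_eval S T \<omega>\<close> is the value \<open>\<omega>(S, T)\<close>; the lemmas below show that it is the unital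
  algebra homomorphism with \<open>X \<mapsto> S\<close> and \<open>Y \<mapsto> T\<close>.\<close>

definition nc_eval :: "'a :: complex_algebra_1 \<Rightarrow> 'a \<Rightarrow> nc_poly \<Rightarrow> 'a" where
  "nc_eval S T \<omega> = (\<Sum>w\<in>Poly_Mapping.keys \<omega>. Poly_Mapping.lookup \<omega> w *\<^sub>C word_eval S T w)"

lemma nc_eval_superset:
  assumes "finite W" "Poly_Mapping.keys \<omega> \<subseteq> W"
  shows "nc_eval S T \<omega> = (\<Sum>w\<in>W. Poly_Mapping.lookup \<omega> w *\<^sub>C word_eval S T w)"
  unfolding nc_eval_def
  by (rule sum.mono_neutral_left) (use assms in \<open>auto simp: in_keys_iff\<close>)

lemma nc_eval_add: "nc_eval S T (\<omega> + \<omega>') = nc_eval S T \<omega> + nc_eval S T \<omega>'"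
proof -
  let ?W = "Poly_Mapping.keys \<omega> \<union> Poly_Mapping.keys \<omega>'"
  have "Poly_Mapping.keys (\<omega> + \<omega>') \<subseteq> ?W" by (rule Poly_Mapping.keys_add)
  then show ?thesis
    by (simp add: nc_eval_superset[where W = ?W] lookup_add scaleC_add_left sum.distrib)
qed

lemma nc_eval_single: "nc_eval S T (Poly_Mapping.single w c) = c *\<^sub>C word_eval S T w"
  by (simp add: nc_eval_superset[where W = "{w}"])

lemma nc_eval_0: "nc_eval S T 0 = 0"
  by (simp add: nc_eval_def)

lemma nc_eval_const: "nc_eval S T (nc_const c) = c *\<^sub>C 1"
  by (simp add: nc_const_def nc_eval_single word_eval_def zero_nc_word_def)

lemma nc_eval_X: "nc_eval S T nc_X = S"
  by (simp add: nc_X_def nc_eval_single word_eval_def scaleC_one)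

lemma nc_eval_Y: "nc_eval S T nc_Y = T"
  by (simp add: nc_Y_def nc_eval_single word_eval_def scaleC_one)

lemma nc_eval_mult: "nc_eval S T (\<omega> * \<omega>') = nc_eval S T \<omega> * nc_eval S T \<omega>'"
proof (induction \<omega> rule: pm_induct)
  case (single u c)
  show ?case
    by (induction \<omega>' rule: pm_induct)
       (simp_all add: mult_single nc_eval_single word_eval_def plus_nc_word_def distrib_left
         nc_eval_add mult_scaleC_left mult_scaleC_right scaleC_scaleC mult.commute[of c])
next
  case (sum f g)
  then show ?case by (simp add: distrib_right nc_eval_add)
qed


section \<open>Commutative polynomials in two variables\<close>

text \<open>\<open>\<complex>[x,y]\<close> is represented as \<open>\<complex>[x][y]\<close>: the coefficient of \<open>x\<^sup>i y\<^sup>j\<close> in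
  \<open>p\<close> is \<open>coeff (coeff p j) i\<close>.\<close>

type_synonym poly2 = "complex poly poly"

definition const2 :: "complex \<Rightarrow> poly2" where "const2 c = [:[:c:]:]"
definition var_x :: poly2 where "var_x = [:[:0, 1:]:]"
definition var_y :: poly2 where "var_y = [:0, 1:]"

definition \<Phi> :: "poly2 \<Rightarrow> nc_poly" where
  "\<Phi> p = (\<Sum>j\<le>degree p. \<Sum>i\<le>degree (coeff p j).
            nc_const (coeff (coeff p j) i) * nc_X ^ i * nc_Y ^ j)"

text \<open>\<open>scale_xy a b p\<close> is \<open>p\<^bsub>a,b\<^esub>(x, y) = p(a x, b y)\<close>.\<close>

definition scale_xy :: "complex \<Rightarrow> complex \<Rightarrow> poly2 \<Rightarrow> poly2" where
  "scale_xy a b p = pcompose (map_poly (\<lambda>q. pcompose q [:0, a:]) p) [:0, [:b:]:]"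

definition scale_y :: "complex \<Rightarrow> poly2 \<Rightarrow> poly2" where
  "scale_y b p = scale_xy 1 b p"

definition quasi_homogeneous :: "poly2 \<Rightarrow> bool" where
  "quasi_homogeneous p \<longleftrightarrow> (\<exists>w1 w2 d :: int. coprime w1 w2 \<and>
     (\<forall>i j. coeff (coeff p j) i \<noteq> 0 \<longrightarrow> w1 * int i + w2 * int j = d))"

lemma coeff_pcompose_scale: "coeff (pcompose q [:0, a:]) n = a ^ n * coeff q n"
  for a :: "'a :: comm_semiring_1"
proof (induction q arbitrary: n)
  case (pCons c q)
  then show ?case by (cases n) (simp_all add: pcompose_pCons mult.assoc)
qed simp

lemma coeff_scale_xy: "coeff (coeff (scale_xy a b p) j) i = a ^ i * b ^ j * coeff (coeff p j) i"
  unfolding scale_xy_def coeff_pcompose_scale poly_const_pow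
  by (simp add: coeff_map_poly coeff_pcompose_scale)


section \<open>Tensor-splitting properties\<close>

text \<open>The types \<open>'a\<close> and \<open>'b\<close> play the role of the two arbitrary algebras; as HOL formulas
  cannot quantify over types, they are parameters of the definitions.\<close>

definition weak_tensor_splitting ::
  "'a :: complex_algebra_1 itself \<Rightarrow> 'b :: complex_algebra_1 itself \<Rightarrow> poly2 \<Rightarrow> bool" where
  "weak_tensor_splitting _ _ p \<longleftrightarrow>
     (\<forall>(S1 :: 'a) (T1 :: 'a) (S2 :: 'b) (T2 :: 'b) (n :: nat).
        \<not> (S1 = 0 \<and> T1 = 0) \<and> \<not> (S2 = 0 \<and> T2 = 0) \<and> n > 0 \<and>
        nc_eval (S1 \<otimes>\<^sub>C S2) (T1 \<otimes>\<^sub>C T2) (\<Phi> (p ^ n)) = 0 \<longrightarrow>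
        (\<exists>a b c d :: complex.
           (\<exists>N. \<forall>l\<ge>N. nc_eval S1 T1 (\<Phi> (scale_xy a b p ^ l)) = 0) \<and>
           (\<exists>N. \<forall>m\<ge>N. nc_eval S2 T2 (\<Phi> (scale_xy c d p ^ m)) = 0)))"

definition strong_tensor_splitting ::
  "'a :: complex_algebra_1 itself \<Rightarrow> 'b :: complex_algebra_1 itself \<Rightarrow> poly2 \<Rightarrow> bool" where
  "strong_tensor_splitting A B p \<longleftrightarrow>
     weak_tensor_splitting A B p \<and>
     (\<forall>(S1 :: 'a) (T1 :: 'a) (S2 :: 'b) (T2 :: 'b) (n :: nat).
        \<not> (S1 = 0 \<and> T1 = 0) \<and> \<not> (S2 = 0 \<and> T2 = 0) \<and> n > 0 \<and>
        left_invertible S1 \<and> right_invertible T1 \<and>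
        left_invertible S2 \<and> right_invertible T2 \<and>
        nc_eval (S1 \<otimes>\<^sub>C S2) (T1 \<otimes>\<^sub>C T2) (\<Phi> (p ^ n)) = 0 \<longrightarrow>
        (\<exists>(a :: complex) b c d (l :: nat) m. l > 0 \<and> m > 0 \<and> l + m = n + 1 \<and>
           nc_eval S1 T1 (\<Phi> (scale_xy a b p ^ l)) = 0 \<and>
           nc_eval S2 T2 (\<Phi> (scale_xy c d p ^ m)) = 0))"

end

theory Submission
  imports Defs
begin

text \<open>
  The polynomials that matter are binomials \<open>p = c x\<^sup>\<alpha> y\<^sup>\<beta> + d y\<^sup>\<gamma>\<close> with \<open>c, d \<noteq> 0\<close>: the
  explicit part of the theorem has \<open>\<gamma> = 0\<close> for the first form of \<open>p\<close> and the exponent \<open>\<beta>\<close>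
  in the place of \<open>\<gamma>\<close> for the second, while \<open>B = 0\<close> would make \<open>p\<close> a monomial, which
  cannot vanish at one-sided invertible elements (\<open>monomial_power_nonzero\<close>). An irreducible
  quasi-homogeneous \<open>p\<close> with \<open>p(0,0) \<noteq> 0\<close> is such a binomial with \<open>\<gamma> = 0\<close>, because its
  exponents lie on a line through the origin, so that \<open>p = f(x\<^sup>\<alpha> y\<^sup>\<beta>)\<close> for some \<open>f\<close> in
  one variable, and a linear factor of \<open>f\<close> gives a factor of \<open>p\<close>. If \<open>p(0,0) = 0\<close>, then
  \<open>p\<^bsub>0,0\<^esub> = 0\<close>, and the scalings \<open>a = b = c = d = 0\<close> already satisfy the definition of
  the tensor-splitting properties.

  Let \<open>p\<close> be a binomial and put \<open>r = - d / c\<close>. For given \<open>S, T\<close>, the linear map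
  \<open>z^k \<mapsto> S^(\<alpha>k) T^(\<beta>k + \<gamma>(n-k))\<close> (\<open>hom_value\<close>) sends \<open>(c z + d)\<^sup>n\<close> to
  \<open>\<Phi>(p\<^sup>n)(S,T)\<close>. If \<open>T\<^sup>\<gamma>\<close> is right-invertible, its kernels for the different \<open>n\<close> are
  the parts of degree at most \<open>n\<close> of a single ideal of \<open>\<complex>[z]\<close> (\<open>relation_ideal\<close>). For
  the two pairs \<open>(S\<^sub>i, T\<^sub>i)\<close> let \<open>g\<close> and \<open>h\<close> generate the two ideals. A linear functional
  on \<open>\<complex>[z]\<close> that kills \<open>(g)\<close> comes from a functional on \<open>A\<^sub>1\<close>, likewise for \<open>(h)\<close> and
  \<open>A\<^sub>2\<close>, and two functionals on \<open>A\<^sub>1\<close> and \<open>A\<^sub>2\<close> have a product on \<open>A\<^sub>1 \<otimes> A\<^sub>2\<close>. Hence the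
  hypothesis \<open>\<Phi>(p\<^sup>n)(S\<^sub>1 \<otimes> S\<^sub>2, T\<^sub>1 \<otimes> T\<^sub>2) = 0\<close> says that \<open>(u v - r)\<^sup>n\<close> is killed by all such
  pairs, one acting on the variable \<open>u\<close>, the other on \<open>v\<close>.

  It remains to insert good functionals, namely Taylor coefficients at roots \<open>s\<close> of \<open>g\<close> and
  \<open>t\<close> of \<open>h\<close> (\<open>paired_ideals_power_of_linear\<close>). Evaluation gives \<open>s t = r\<close>. As this holds
  for all roots and \<open>r \<noteq> 0\<close>, each of \<open>g, h\<close> has just one root, so up to units
  \<open>g = (u - s)\<^sup>l\<close> and \<open>h = (v - t)\<^sup>m\<close>. With
  \<open>u v - r = s (v - t) + t (u - s) + (u - s)(v - t)\<close>, the coefficient of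
  \<open>(u - s)\<^sup>j (v - t)\<^sup>i\<close> in \<open>(u v - r)\<^sup>n\<close> for \<open>i + j = n\<close> is a nonzero multiple of
  \<open>s\<^sup>i t\<^sup>j\<close>. It would have to vanish if \<open>j < l\<close> and \<open>i < m\<close>, whence \<open>l + m \<le> n + 1\<close>.
  Finally \<open>(u - s)\<^sup>l\<close> in the ideal means \<open>\<Phi>(p\<^bsub>a,b\<^esub>\<^sup>l)(S\<^sub>1,T\<^sub>1) = 0\<close> for all scalings that
  move the root of the binomial to \<open>s\<close>, and similarly for \<open>t\<close>.
\<close>

section \<open>Ordered evaluation\<close>

lemma nc_eval_sum: "nc_eval S T (\<Sum>i\<in>I. f i) = (\<Sum>i\<in>I. nc_eval S T (f i))"
  by (induction I rule: infinite_finite_induct) (simp_all add: nc_eval_0 nc_eval_add)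

lemma nc_eval_one: "nc_eval S T 1 = 1"
  using nc_eval_const[of S T 1] by (simp add: nc_const_def scaleC_one)

lemma nc_eval_power: "nc_eval S T (\<omega> ^ n) = nc_eval S T \<omega> ^ n"
  by (induction n) (simp_all add: nc_eval_one nc_eval_mult)

text \<open>Summing over a box that does not depend on the polynomial makes the additivity of
  \<open>p \<mapsto> \<Phi>(p)(S, T)\<close> visible, which the definition by degrees hides.\<close>

lemma nc_eval_Phi_bounds:
  assumes "degree p \<le> N" "\<And>j. degree (coeff p j) \<le> M"
  shows "nc_eval S T (\<Phi> p) = (\<Sum>j\<le>N. \<Sum>i\<le>M. coeff (coeff p j) i *\<^sub>C (S ^ i * T ^ j))"
proof -
  have "nc_eval S T (\<Phi> p)
      = (\<Sum>j\<le>degree p. \<Sum>i\<le>degree (coeff p j). coeff (coeff p j) i *\<^sub>C (S ^ i * T ^ j))"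
    by (simp add: \<Phi>_def nc_eval_sum nc_eval_mult nc_eval_power nc_eval_const nc_eval_X nc_eval_Y
        mult_scaleC_left)
  also have "\<dots> = (\<Sum>j\<le>degree p. \<Sum>i\<le>M. coeff (coeff p j) i *\<^sub>C (S ^ i * T ^ j))"
    using assms(2) by (intro sum.cong refl sum.mono_neutral_left) (auto simp: coeff_eq_0)
  also have "\<dots> = (\<Sum>j\<le>N. \<Sum>i\<le>M. coeff (coeff p j) i *\<^sub>C (S ^ i * T ^ j))"
    using assms(1) by (intro sum.mono_neutral_left) (auto simp: coeff_eq_0)
  finally show ?thesis .
qed

lemma inner_degree_bounded: "\<exists>M. \<forall>j. degree (coeff p j) \<le> M"
proof (intro exI allI)
  fix j
  show "degree (coeff p j) \<le> Max (insert 0 ((\<lambda>j. degree (coeff p j)) ` {..degree p}))"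
    by (cases "j \<le> degree p") (auto simp: coeff_eq_0 intro!: Max_ge)
qed

lemma nc_eval_Phi_add: "nc_eval S T (\<Phi> (p + q)) = nc_eval S T (\<Phi> p) + nc_eval S T (\<Phi> q)"
proof -
  obtain M1 M2 where M: "degree (coeff p j) \<le> M1" "degree (coeff q j) \<le> M2" for j
    using inner_degree_bounded[of p] inner_degree_bounded[of q] by blast
  define M where "M = max M1 M2"
  define N where "N = max (degree p) (degree q)"
  have le: "degree (coeff p j) \<le> M" "degree (coeff q j) \<le> M" for j
    using M[of j] by (simp_all add: M_def)
  have "degree (coeff (p + q) j) \<le> M" for j
    using le[of j] by (simp add: degree_add_le)
  moreover have "degree (p + q) \<le> N" "degree p \<le> N" "degree q \<le> N"
    by (simp_all add: N_def degree_add_le)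
  ultimately show ?thesis
    using le by (simp add: nc_eval_Phi_bounds[where N = N and M = M] scaleC_add_left sum.distrib)
qed

lemma nc_eval_Phi_zero: "nc_eval S T (\<Phi> 0) = 0"
  by (simp add: \<Phi>_def nc_const_def nc_eval_0)

lemma nc_eval_Phi_sum:
  "nc_eval S T (\<Phi> (\<Sum>i\<in>I. f i)) = (\<Sum>i\<in>I. nc_eval S T (\<Phi> (f i)))"
  by (induction I rule: infinite_finite_induct) (simp_all add: nc_eval_Phi_zero nc_eval_Phi_add)

lemma const2_mult: "const2 (a * b) = const2 a * const2 b"
  by (simp add: const2_def)

lemma const2_power: "const2 (a ^ k) = const2 a ^ k"
  by (simp add: const2_def poly_const_pow)

lemma const2_sum: "const2 (\<Sum>k\<in>I. f k) = (\<Sum>k\<in>I. const2 (f k))"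
  by (simp add: const2_def sum_to_poly)

lemma const2_of_nat: "const2 (of_nat k) = of_nat k"
  by (simp add: const2_def of_nat_poly)

lemma const2_0: "const2 0 = 0"
  by (simp add: const2_def)

lemma const2_uminus: "const2 (- a) = - const2 a"
  by (simp add: const2_def)

lemma monomial_conv_monom: "const2 c * var_x ^ i * var_y ^ j = monom (monom c i) j"
  by (simp add: const2_def var_x_def var_y_def monom_altdef poly_const_pow)

lemma nc_eval_Phi_monomial:
  "nc_eval S T (\<Phi> (const2 c * var_x ^ i * var_y ^ j)) = c *\<^sub>C (S ^ i * T ^ j)"
proof -
  let ?p = "monom (monom c i) j :: poly2"
  have "degree ?p \<le> j" "degree (coeff ?p j') \<le> i" for j'
    by (simp_all add: degree_monom_le)
  then have "nc_eval S T (\<Phi> ?p)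
      = (\<Sum>j'\<le>j. \<Sum>i'\<le>i. coeff (coeff ?p j') i' *\<^sub>C (S ^ i' * T ^ j'))"
    by (rule nc_eval_Phi_bounds)
  also have "\<dots> = (\<Sum>j'\<le>j. if j' = j then c *\<^sub>C (S ^ i * T ^ j) else 0)"
  proof (intro sum.cong refl)
    fix j'
    show "(\<Sum>i'\<le>i. coeff (coeff ?p j') i' *\<^sub>C (S ^ i' * T ^ j'))
        = (if j' = j then c *\<^sub>C (S ^ i * T ^ j) else 0)"
      by (simp add: sum.delta' if_distrib[of "\<lambda>z. z *\<^sub>C _"] cong: if_cong)
  qed
  finally show ?thesis by (simp add: monomial_conv_monom)
qed


section \<open>Linear functionals on a tensor product\<close>

interpretation alg: vector_space "scaleC :: complex \<Rightarrow> 'a :: complex_algebra_1 \<Rightarrow> 'a"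
  by unfold_locales (simp_all add: scaleC_add_left scaleC_add_right scaleC_scaleC scaleC_one)

text \<open>For \<open>(*)\<close> this stays a lemma: interpreting the locale would declare
  \<open>a * (b * c) = (a * b) * c\<close> as a simplification rule, against \<open>mult.assoc\<close>.\<close>

lemma complex_vector_space: "vector_space ((*) :: complex \<Rightarrow> complex \<Rightarrow> complex)"
  by unfold_locales (simp_all add: algebra_simps)

interpretation cpoly: vector_space "smult :: complex \<Rightarrow> complex poly \<Rightarrow> complex poly"
  by unfold_locales (simp_all add: smult_add_left smult_add_right)

text \<open>The linear functional on the free vector space that takes the value \<open>w k\<close> on the basis
  symbol \<open>k\<close>.\<close>

definition weighted_sum :: "('k \<Rightarrow> complex) \<Rightarrow> ('k \<Rightarrow>\<^sub>0 complex) \<Rightarrow> complex" where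
  "weighted_sum w f = (\<Sum>k\<in>Poly_Mapping.keys f. Poly_Mapping.lookup f k * w k)"

lemma weighted_sum_superset:
  assumes "finite W" "Poly_Mapping.keys f \<subseteq> W"
  shows "weighted_sum w f = (\<Sum>k\<in>W. Poly_Mapping.lookup f k * w k)"
  unfolding weighted_sum_def
  by (rule sum.mono_neutral_left) (use assms in \<open>auto simp: in_keys_iff\<close>)

lemma weighted_sum_add: "weighted_sum w (f + g) = weighted_sum w f + weighted_sum w g"
proof -
  let ?W = "Poly_Mapping.keys f \<union> Poly_Mapping.keys g"
  have "Poly_Mapping.keys (f + g) \<subseteq> ?W" by (rule Poly_Mapping.keys_add)
  then show ?thesis
    by (simp add: weighted_sum_superset[where W = ?W] lookup_add distrib_right sum.distrib)
qed

lemma weighted_sum_scale: "weighted_sum w (fv_scale c f) = c * weighted_sum w f"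
proof -
  have "Poly_Mapping.keys (fv_scale c f) \<subseteq> Poly_Mapping.keys f"
    by (auto simp: in_keys_iff)
  show ?thesis
    unfolding weighted_sum_superset[OF finite_keys \<open>Poly_Mapping.keys (fv_scale c f) \<subseteq> _\<close>]
      weighted_sum_def[of w f] sum_distrib_left lookup_fv_scale mult.assoc ..
qed

lemma weighted_sum_diff: "weighted_sum w (f - g) = weighted_sum w f - weighted_sum w g"
  using weighted_sum_add[of w "f - g" g] by simp

lemma weighted_sum_single: "weighted_sum w (Poly_Mapping.single k c) = c * w k"
  by (simp add: weighted_sum_superset[where W = "{k}"])

text \<open>Bilinearity of \<open>(a, b) \<mapsto> \<phi>(a) \<psi>(b)\<close> is exactly what makes the relations vanish, so
  that the product of two functionals descends to the tensor product.\<close>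

lemma weighted_sum_tensor_null:
  assumes \<phi>: "Vector_Spaces.linear scaleC (*) \<phi>" and \<psi>: "Vector_Spaces.linear scaleC (*) \<psi>"
    and "f \<in> tensor_null"
  shows "weighted_sum (case_tgen (\<lambda>a b. \<phi> a * \<psi> b)) f = 0"
proof -
  interpret \<phi>: Vector_Spaces.linear scaleC "(*)" \<phi> by (rule \<phi>)
  interpret \<psi>: Vector_Spaces.linear scaleC "(*)" \<psi> by (rule \<psi>)
  let ?w = "weighted_sum (case_tgen (\<lambda>a b. \<phi> a * \<psi> b))"
  have rel: "?w x = 0" if "x \<in> tensor_relations" for x
  proof -
    have "?w (Poly_Mapping.single (TGen (a + a') b) 1 - Poly_Mapping.single (TGen a b) 1
              - Poly_Mapping.single (TGen a' b) 1) = 0"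
         "?w (Poly_Mapping.single (TGen a (b + b')) 1 - Poly_Mapping.single (TGen a b) 1
              - Poly_Mapping.single (TGen a b') 1) = 0"
         "?w (Poly_Mapping.single (TGen (c *\<^sub>C a) b) 1
              - fv_scale c (Poly_Mapping.single (TGen a b) 1)) = 0"
         "?w (Poly_Mapping.single (TGen a (c *\<^sub>C b)) 1
              - fv_scale c (Poly_Mapping.single (TGen a b) 1)) = 0" for a a' b b' c
      by (simp_all only: weighted_sum_diff weighted_sum_scale weighted_sum_single tgen.case
          \<phi>.add \<psi>.add \<phi>.scale \<psi>.scale distrib_left distrib_right) simp_all
    with that show ?thesis unfolding tensor_relations_def by blast
  qed
  show ?thesis
    using assms(3) unfolding tensor_null_def
  proof (induction rule: fv.span_induct_alt)
    case base
    show ?case by (simp add: weighted_sum_def)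
  next
    case (step c x y)
    then show ?case by (simp add: weighted_sum_add weighted_sum_scale rel)
  qed
qed

text \<open>The product of two arbitrary maps need not respect the tensor relations; the default value
  \<open>0\<close> for maps that are not linear makes the function well defined on the quotient.\<close>

lift_definition tensor_functional ::
  "('a :: complex_algebra_1 \<Rightarrow> complex) \<Rightarrow> ('b :: complex_algebra_1 \<Rightarrow> complex)
     \<Rightarrow> ('a, 'b) tensor \<Rightarrow> complex"
  is "\<lambda>\<phi> \<psi> f. if Vector_Spaces.linear scaleC (*) \<phi> \<and> Vector_Spaces.linear scaleC (*) \<psi>
        then weighted_sum (case_tgen (\<lambda>a b. \<phi> a * \<psi> b)) f else 0"
proof -
  fix \<phi> :: "'a \<Rightarrow> complex" and \<psi> :: "'b \<Rightarrow> complex" and f g :: "('a, 'b) tgen \<Rightarrow>\<^sub>0 complex"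
  assume "f - g \<in> tensor_null"
  from weighted_sum_tensor_null[OF _ _ this, of \<phi> \<psi>]
  show "(if Vector_Spaces.linear scaleC (*) \<phi> \<and> Vector_Spaces.linear scaleC (*) \<psi>
        then weighted_sum (case_tgen (\<lambda>a b. \<phi> a * \<psi> b)) f else 0)
      = (if Vector_Spaces.linear scaleC (*) \<phi> \<and> Vector_Spaces.linear scaleC (*) \<psi>
        then weighted_sum (case_tgen (\<lambda>a b. \<phi> a * \<psi> b)) g else 0)"
    by (auto simp only: weighted_sum_diff right_minus_eq split: if_splits)
qed

lemma tensor_functional_add:
  "tensor_functional \<phi> \<psi> (x + y) = tensor_functional \<phi> \<psi> x + tensor_functional \<phi> \<psi> y"
  by transfer (simp add: weighted_sum_add)

lemma tensor_functional_scaleC: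
  "tensor_functional \<phi> \<psi> (c *\<^sub>C x) = c * tensor_functional \<phi> \<psi> x"
  by transfer (simp add: weighted_sum_scale)

lemma tensor_functional_zero: "tensor_functional \<phi> \<psi> 0 = 0"
  using tensor_functional_scaleC[of \<phi> \<psi> 0 0] by simp

lemma tensor_functional_sum:
  "tensor_functional \<phi> \<psi> (\<Sum>i\<in>I. x i) = (\<Sum>i\<in>I. tensor_functional \<phi> \<psi> (x i))"
  by (induction I rule: infinite_finite_induct)
     (simp_all add: tensor_functional_add tensor_functional_zero)

lemma tensor_functional_pure:
  assumes "Vector_Spaces.linear scaleC (*) \<phi>" "Vector_Spaces.linear scaleC (*) \<psi>"
  shows "tensor_functional \<phi> \<psi> (a \<otimes>\<^sub>C b) = \<phi> a * \<psi> b"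
  using assms by transfer (simp add: weighted_sum_single)

lemma pure_tensor_power: "(a \<otimes>\<^sub>C b) ^ n = (a ^ n) \<otimes>\<^sub>C (b ^ n)"
  by (induction n) (simp_all add: one_tensor_eq pure_tensor_mult)

text \<open>A functional that kills the kernel of \<open>u\<close> on \<open>V\<close> is induced by a functional on the target:
  compose it with a linear right inverse of \<open>u\<close>.\<close>

lemma functional_factors_through:
  fixes u :: "complex poly \<Rightarrow> 'a :: complex_algebra_1"
  assumes u: "Vector_Spaces.linear smult scaleC u" and D: "Vector_Spaces.linear smult (*) D"
    and V: "cpoly.subspace V" and ker: "\<And>f. f \<in> V \<Longrightarrow> u f = 0 \<Longrightarrow> D f = 0"
  obtains \<phi> where "Vector_Spaces.linear scaleC (*) \<phi>" "\<And>f. f \<in> V \<Longrightarrow> \<phi> (u f) = D f"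
proof -
  interpret vector_space_pair "smult :: complex \<Rightarrow> _" "scaleC :: complex \<Rightarrow> 'a \<Rightarrow> 'a" ..
  interpret u: Vector_Spaces.linear smult scaleC u by (rule u)
  interpret D: Vector_Spaces.linear smult "(*)" D by (rule D)
  obtain g where g: "range g \<subseteq> V" "Vector_Spaces.linear scaleC smult g"
      "\<And>y. y \<in> u ` V \<Longrightarrow> u (g y) = y"
    using linear_exists_right_inverse_on[OF u V] by blast
  have "D (g (u f)) = D f" if f: "f \<in> V" for f
  proof -
    have "g (u f) - f \<in> V" using g(1) f by (auto intro: cpoly.subspace_diff[OF V])
    moreover have "u (g (u f) - f) = 0" using g(3)[of "u f"] f by (simp add: u.diff)
    ultimately have "D (g (u f) - f) = 0" by (rule ker)
    then show ?thesis by (simp add: D.diff)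
  qed
  moreover have "Vector_Spaces.linear scaleC (*) (D \<circ> g)"
    using g(2) D by (rule Vector_Spaces.linear_compose)
  ultimately show ?thesis using that[of "D \<circ> g"] by simp
qed

text \<open>Extend \<open>1 \<mapsto> 1\<close> to functionals on both factors and evaluate their product.\<close>

lemma one_tensor_one_nonzero:
  assumes "(1 :: 'a :: complex_algebra_1) \<noteq> 0" "(1 :: 'b :: complex_algebra_1) \<noteq> 0"
  shows "(1 :: 'a) \<otimes>\<^sub>C (1 :: 'b) \<noteq> 0"
proof -
  interpret vector_space_pair "scaleC :: complex \<Rightarrow> 'a \<Rightarrow> 'a" "(*) :: complex \<Rightarrow> complex \<Rightarrow> complex"
    by (intro vector_space_pair.intro alg.vector_space_axioms complex_vector_space)
  obtain \<phi> :: "'a \<Rightarrow> complex" where \<phi>: "Vector_Spaces.linear scaleC (*) \<phi>" "\<phi> 1 = 1"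
    using linear_independent_extend[of "{1}" "\<lambda>_. 1"] assms by auto
  interpret b: vector_space_pair "scaleC :: complex \<Rightarrow> 'b \<Rightarrow> 'b" "(*) :: complex \<Rightarrow> complex \<Rightarrow> complex"
    by (intro vector_space_pair.intro alg.vector_space_axioms complex_vector_space)
  obtain \<psi> :: "'b \<Rightarrow> complex" where \<psi>: "Vector_Spaces.linear scaleC (*) \<psi>" "\<psi> 1 = 1"
    using b.linear_independent_extend[of "{1}" "\<lambda>_. 1"] assms by auto
  have "tensor_functional \<phi> \<psi> (1 \<otimes>\<^sub>C 1) = 1"
    using \<phi> \<psi> by (simp add: tensor_functional_pure)
  then show ?thesis by (auto simp: tensor_functional_zero)
qed

section \<open>Binomials and the ideals they define\<close>

text \<open>The polynomial \<open>f\<close>, homogenized to degree \<open>n\<close>, at \<open>x\<^sup>\<alpha> y\<^sup>\<beta>\<close> and \<open>y\<^sup>\<gamma>\<close>, with the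
  powers of \<open>S\<close> collected to the left of those of \<open>T\<close> as \<open>\<Phi>\<close> demands. For \<open>\<gamma> = 0\<close> this
  covers \<open>x\<^sup>\<alpha> y\<^sup>\<beta> - B\<close>, for \<open>\<beta> = 0\<close> it covers \<open>B x\<^sup>\<alpha> - y\<^sup>\<gamma>\<close>.\<close>

definition hom_value ::
  "'a :: complex_algebra_1 \<Rightarrow> 'a \<Rightarrow> nat \<Rightarrow> nat \<Rightarrow> nat \<Rightarrow> nat \<Rightarrow> complex poly \<Rightarrow> 'a" where
  "hom_value S T \<alpha> \<beta> \<gamma> n f = (\<Sum>k\<le>n. coeff f k *\<^sub>C (S ^ (\<alpha> * k) * T ^ (\<beta> * k + \<gamma> * (n - k))))"

lemma binomial_power_expansion:
  "(const2 c * var_x ^ \<alpha> * var_y ^ \<beta> + const2 d * var_y ^ \<gamma>) ^ n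
     = (\<Sum>k\<le>n. const2 (coeff ([:d, c:] ^ n) k) * var_x ^ (\<alpha> * k) * var_y ^ (\<beta> * k + \<gamma> * (n - k)))"
proof -
  show ?thesis
    unfolding binomial_ring
  proof (intro sum.cong refl)
    fix k assume "k \<in> {..n}"
    then have "const2 (coeff ([:d, c:] ^ n) k) = of_nat (n choose k) * const2 c ^ k * const2 d ^ (n - k)"
      by (simp add: coeff_linear_poly_power const2_mult const2_power const2_of_nat)
    then show "of_nat (n choose k) * (const2 c * var_x ^ \<alpha> * var_y ^ \<beta>) ^ k
          * (const2 d * var_y ^ \<gamma>) ^ (n - k)
        = const2 (coeff ([:d, c:] ^ n) k) * var_x ^ (\<alpha> * k) * var_y ^ (\<beta> * k + \<gamma> * (n - k))"
      by (simp add: power_mult_distrib power_mult power_add mult_ac)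
  qed
qed

lemma nc_eval_Phi_binomial_power:
  "nc_eval S T (\<Phi> ((const2 c * var_x ^ \<alpha> * var_y ^ \<beta> + const2 d * var_y ^ \<gamma>) ^ n))
     = hom_value S T \<alpha> \<beta> \<gamma> n ([:d, c:] ^ n)"
  by (simp add: binomial_power_expansion nc_eval_Phi_sum nc_eval_Phi_monomial hom_value_def)

lemma hom_value_add: "hom_value S T \<alpha> \<beta> \<gamma> n (f + g) = hom_value S T \<alpha> \<beta> \<gamma> n f + hom_value S T \<alpha> \<beta> \<gamma> n g"
  by (simp add: hom_value_def scaleC_add_left sum.distrib)

lemma hom_value_smult: "hom_value S T \<alpha> \<beta> \<gamma> n (smult c f) = c *\<^sub>C hom_value S T \<alpha> \<beta> \<gamma> n f"
  by (simp add: hom_value_def alg.scale_sum_right)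

lemma hom_value_linear: "Vector_Spaces.linear smult scaleC (hom_value S T \<alpha> \<beta> \<gamma> n)"
  by (intro Vector_Spaces.linear.intro module_hom.intro module_hom_axioms.intro
      alg.vector_space_axioms cpoly.vector_space_axioms alg.module_axioms cpoly.module_axioms
      vector_space_pair.intro hom_value_add hom_value_smult)

text \<open>Raising the degree of homogenization multiplies by \<open>T\<^sup>\<gamma>\<close> on the right, and multiplying the
  polynomial by its variable multiplies by \<open>S\<^sup>\<alpha>\<close> on the left and \<open>T\<^sup>\<beta>\<close> on the right. These
  two rules turn the kernels into an ideal, although the values themselves do not multiply.\<close>

lemma hom_value_Suc:
  assumes "degree f \<le> n"
  shows "hom_value S T \<alpha> \<beta> \<gamma> (Suc n) f = hom_value S T \<alpha> \<beta> \<gamma> n f * T ^ \<gamma>"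
proof -
  have "coeff f (Suc n) = 0" using assms by (simp add: coeff_eq_0)
  moreover have "T ^ (\<beta> * k + \<gamma> * (Suc n - k)) = T ^ (\<beta> * k + \<gamma> * (n - k)) * T ^ \<gamma>" if "k \<le> n" for k
  proof -
    have "\<beta> * k + \<gamma> * (Suc n - k) = \<beta> * k + \<gamma> * (n - k) + \<gamma>"
      using that by (simp add: Suc_diff_le)
    then show ?thesis by (simp only: power_add mult.assoc)
  qed
  ultimately show ?thesis
    by (simp add: hom_value_def sum_distrib_right mult_scaleC_left mult.assoc)
qed

lemma hom_value_shift:
  "hom_value S T \<alpha> \<beta> \<gamma> (Suc n) (pCons 0 f) = S ^ \<alpha> * hom_value S T \<alpha> \<beta> \<gamma> n f * T ^ \<beta>"
proof -
  have "S ^ (\<alpha> * Suc k) * T ^ (\<beta> * Suc k + \<gamma> * (Suc n - Suc k))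
      = S ^ \<alpha> * (S ^ (\<alpha> * k) * T ^ (\<beta> * k + \<gamma> * (n - k))) * T ^ \<beta>" for k
  proof -
    have "T ^ (\<beta> * Suc k + \<gamma> * (Suc n - Suc k)) = T ^ (\<beta> * k + \<gamma> * (n - k)) * T ^ \<beta>"
      by (simp add: power_add[symmetric] algebra_simps)
    moreover have "S ^ (\<alpha> * Suc k) = S ^ \<alpha> * S ^ (\<alpha> * k)"
      by (simp add: power_add)
    ultimately show ?thesis by (simp only: mult.assoc)
  qed
  then show ?thesis
    unfolding hom_value_def sum.atMost_Suc_shift
    by (simp add: sum_distrib_left sum_distrib_right mult_scaleC_left mult_scaleC_right
        del: mult_Suc_right diff_Suc_Suc)
qed

lemma hom_value_eq_0_degree:
  assumes "right_invertible (T ^ \<gamma>)" "degree f \<le> n"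
  shows "hom_value S T \<alpha> \<beta> \<gamma> n f = 0 \<longleftrightarrow> hom_value S T \<alpha> \<beta> \<gamma> (degree f) f = 0"
  using assms(2)
proof (induction n rule: dec_induct)
  case (step n)
  obtain R where R: "T ^ \<gamma> * R = 1" using assms(1) by (auto simp: right_invertible_def)
  have "hom_value S T \<alpha> \<beta> \<gamma> n f = hom_value S T \<alpha> \<beta> \<gamma> (Suc n) f * R"
    using step.hyps by (simp add: hom_value_Suc mult.assoc R)
  then have "hom_value S T \<alpha> \<beta> \<gamma> (Suc n) f = 0 \<longleftrightarrow> hom_value S T \<alpha> \<beta> \<gamma> n f = 0"
    using step.hyps by (auto simp: hom_value_Suc)
  then show ?case using step.IH by simp
qed simp

text \<open>Homogenizing to the exact degree makes membership a condition on \<open>f\<close> alone; by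
  \<open>hom_value_eq_0_iff\<close> every larger degree gives the same condition when \<open>T\<^sup>\<gamma>\<close> is
  right-invertible.\<close>

definition relation_ideal ::
  "'a :: complex_algebra_1 \<Rightarrow> 'a \<Rightarrow> nat \<Rightarrow> nat \<Rightarrow> nat \<Rightarrow> complex poly set" where
  "relation_ideal S T \<alpha> \<beta> \<gamma> = {f. hom_value S T \<alpha> \<beta> \<gamma> (degree f) f = 0}"

lemma hom_value_eq_0_iff:
  assumes "right_invertible (T ^ \<gamma>)" "degree f \<le> n"
  shows "hom_value S T \<alpha> \<beta> \<gamma> n f = 0 \<longleftrightarrow> f \<in> relation_ideal S T \<alpha> \<beta> \<gamma>"
  using hom_value_eq_0_degree[OF assms] by (simp add: relation_ideal_def)

lemma relation_ideal_add:
  assumes T: "right_invertible (T ^ \<gamma>)"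
    and "f \<in> relation_ideal S T \<alpha> \<beta> \<gamma>" "g \<in> relation_ideal S T \<alpha> \<beta> \<gamma>"
  shows "f + g \<in> relation_ideal S T \<alpha> \<beta> \<gamma>"
proof -
  define n where "n = max (degree f) (degree g)"
  have "degree f \<le> n" "degree g \<le> n" "degree (f + g) \<le> n"
    by (simp_all add: n_def degree_add_le)
  then show ?thesis
    using assms(2,3) by (simp flip: hom_value_eq_0_iff[OF T, of _ n] add: hom_value_add)
qed

lemma relation_ideal_mult:
  assumes T: "right_invertible (T ^ \<gamma>)" and f: "f \<in> relation_ideal S T \<alpha> \<beta> \<gamma>"
  shows "q * f \<in> relation_ideal S T \<alpha> \<beta> \<gamma>"
proof (induction q)
  case 0
  show ?case by (simp add: relation_ideal_def hom_value_def)
next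
  case (pCons c q)
  have "hom_value S T \<alpha> \<beta> \<gamma> (degree f) (smult c f) = 0"
    using f by (simp add: relation_ideal_def hom_value_smult)
  then have "smult c f \<in> relation_ideal S T \<alpha> \<beta> \<gamma>"
    by (simp add: hom_value_eq_0_iff[OF T] degree_smult_le)
  moreover have "hom_value S T \<alpha> \<beta> \<gamma> (Suc (degree (q * f))) (pCons 0 (q * f)) = 0"
    using pCons.IH by (simp add: relation_ideal_def hom_value_shift)
  then have "pCons 0 (q * f) \<in> relation_ideal S T \<alpha> \<beta> \<gamma>"
    by (simp add: hom_value_eq_0_iff[OF T] degree_pCons_le)
  ultimately show ?case
    unfolding mult_pCons_left by (rule relation_ideal_add[OF T])
qed

lemma one_notin_relation_ideal:
  assumes "(1 :: 'a :: complex_algebra_1) \<noteq> 0"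
  shows "1 \<notin> relation_ideal S (T :: 'a) \<alpha> \<beta> \<gamma>"
  using assms by (simp add: relation_ideal_def hom_value_def scaleC_one)

lemma complex_poly_ideal_principal:
  fixes I :: "complex poly set"
  assumes zero: "0 \<in> I" and add: "\<And>f g. f \<in> I \<Longrightarrow> g \<in> I \<Longrightarrow> f + g \<in> I"
    and mult: "\<And>q f. f \<in> I \<Longrightarrow> q * f \<in> I"
  obtains g where "\<And>f. f \<in> I \<longleftrightarrow> g dvd f"
proof (cases "I \<subseteq> {0}")
  case True
  then show ?thesis using that[of 0] zero by auto
next
  case False
  then obtain g where g: "g \<in> I" "g \<noteq> 0"
      and min: "\<And>f. f \<in> I \<Longrightarrow> f \<noteq> 0 \<Longrightarrow> degree g \<le> degree f"
    using ex_has_least_nat[of "\<lambda>f. f \<in> I \<and> f \<noteq> 0" _ degree] by blast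
  have "g dvd f" if "f \<in> I" for f
  proof -
    have "f mod g = f + (- (f div g)) * g"
      by (simp add: minus_div_mult_eq_mod[symmetric])
    also have "\<dots> \<in> I" using that g(1) by (intro add mult)
    finally have "f mod g = 0"
      using min[of "f mod g"] degree_mod_less[OF g(2), of f] by linarith
    then show ?thesis by (rule mod_0_imp_dvd)
  qed
  moreover have "f \<in> I" if "g dvd f" for f
    using that mult[OF g(1)] by (auto simp: dvd_def mult.commute)
  ultimately have "f \<in> I \<longleftrightarrow> g dvd f" for f
    by (intro iffI)
  then show ?thesis by (rule that)
qed

lemma relation_ideal_generator:
  assumes "right_invertible (T ^ \<gamma>)" "(1 :: 'a :: complex_algebra_1) \<noteq> 0"
  obtains g where "\<And>f. f \<in> relation_ideal S (T :: 'a) \<alpha> \<beta> \<gamma> \<longleftrightarrow> g dvd f" "\<not> is_unit g"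
proof -
  let ?I = "relation_ideal S T \<alpha> \<beta> \<gamma>"
  obtain g where g: "\<And>f. f \<in> ?I \<longleftrightarrow> g dvd f"
  proof (rule complex_poly_ideal_principal[of ?I])
    show "0 \<in> ?I" by (simp add: relation_ideal_def hom_value_def)
  qed (use relation_ideal_add relation_ideal_mult assms(1) in blast)+
  moreover have "\<not> is_unit g"
    using one_notin_relation_ideal[OF assms(2)] by (simp flip: g)
  ultimately show ?thesis by (rule that)
qed


section \<open>Pairing Taylor coefficients\<close>

text \<open>The coefficient of \<open>(u - s)\<^sup>j\<close> in the expansion of \<open>f\<close> at \<open>s\<close>. For \<open>j < l\<close> these are
  functionals that kill the ideal generated by \<open>(u - s)\<^sup>l\<close>.\<close>

definition taylor_coeff :: "complex \<Rightarrow> nat \<Rightarrow> complex poly \<Rightarrow> complex" where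
  "taylor_coeff s j f = coeff (pcompose f [:s, 1:]) j"

lemma taylor_coeff_linear: "Vector_Spaces.linear smult (*) (taylor_coeff s j)"
  by unfold_locales
     (simp_all add: taylor_coeff_def pcompose_add pcompose_smult smult_add_left smult_add_right
       distrib_left distrib_right)

lemma pcompose_power: "pcompose (p ^ k) q = pcompose p q ^ k"
  for p q :: "'a :: comm_semiring_1 poly"
  by (induction k) (simp_all add: pcompose_mult pcompose_1)

lemma taylor_coeff_monom: "taylor_coeff s j (monom 1 k) = coeff ([:s, 1:] ^ k) j"
  by (simp add: taylor_coeff_def monom_altdef pcompose_power pcompose_pCons)

lemma taylor_coeff_eq_0:
  assumes "[:- s, 1:] ^ l dvd f" "j < l"
  shows "taylor_coeff s j f = 0"
proof -
  obtain q where "f = [:- s, 1:] ^ l * q" using assms(1) by (auto simp: dvd_def)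
  moreover have "pcompose ([:- s, 1:] ^ l) [:s, 1:] = monom 1 l"
    by (simp add: pcompose_power pcompose_pCons monom_altdef)
  ultimately show ?thesis
    using assms(2) by (simp add: taylor_coeff_def pcompose_mult coeff_monom_mult)
qed

text \<open>Both sides are the coefficient of \<open>(u - s)\<^sup>j (v - t)\<^sup>i\<close> in \<open>(u v - r)\<^sup>n\<close>. On the right
  \<open>u v - r\<close> is written as a linear polynomial in \<open>v - t\<close> with coefficients in
  \<open>\<complex>[u - s]\<close>.\<close>

lemma taylor_pairing:
  "(\<Sum>k\<le>n. coeff ([:- r, 1:] ^ n) k * (taylor_coeff s j (monom 1 k) * taylor_coeff t i (monom 1 k)))
     = coeff (coeff ([:[:s * t - r, t:], [:s, 1:]:] ^ n) i) j"
proof -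
  have coeff_t: "coeff ([:[:t:], 1:] ^ k) i = [:coeff ([:t, 1:] ^ k) i:]" for k
  proof (cases "i \<le> k")
    case True
    then show ?thesis by (simp add: coeff_linear_poly_power poly_const_pow of_nat_poly)
  next
    case False
    then have "degree ([:[:t:], 1:] ^ k) < i" "degree ([:t, 1:] ^ k) < i"
      by (simp_all add: degree_linear_power not_le degree_power_eq)
    then show ?thesis by (simp add: coeff_eq_0)
  qed
  define u v :: "complex poly poly" where "u = [:[:s, 1:]:]" and "v = [:[:t:], 1:]"
  have "[:[:s * t - r, t:], [:s, 1:]:] = u * v + [:[:- r:]:]"
    by (simp add: u_def v_def algebra_simps)
  also have "\<dots> ^ n = (\<Sum>k\<le>n. [:[:coeff ([:- r, 1:] ^ n) k:]:] * u ^ k * v ^ k)"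
    unfolding binomial_ring
    by (intro sum.cong refl)
       (simp add: coeff_linear_poly_power power_mult_distrib poly_const_pow of_nat_poly mult_ac)
  also have "\<dots> = (\<Sum>k\<le>n. [:[:coeff ([:- r, 1:] ^ n) k:] * [:s, 1:] ^ k:] * [:[:t:], 1:] ^ k)"
    by (simp add: u_def v_def poly_const_pow)
  also have "coeff (coeff \<dots> i) j = (\<Sum>k\<le>n. coeff ([:- r, 1:] ^ n) k
        * (coeff ([:s, 1:] ^ k) j * coeff ([:t, 1:] ^ k) i))"
    by (simp add: coeff_sum coeff_t mult_ac)
  finally show ?thesis by (simp add: taylor_coeff_monom)
qed

lemma taylor_pairing_bottom:
  "(\<Sum>k\<le>n. coeff ([:- r, 1:] ^ n) k * (taylor_coeff s 0 (monom 1 k) * taylor_coeff t 0 (monom 1 k)))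
     = (s * t - r) ^ n"
  by (simp add: taylor_pairing coeff_0_power)

text \<open>If \<open>s t = r\<close>, then \<open>u v - r\<close> has no constant term at \<open>(s, t)\<close>, and the terms of total
  degree \<open>n\<close> of its \<open>n\<close>-th power come from the linear part \<open>t (u - s) + s (v - t)\<close> alone.\<close>

lemma taylor_pairing_top:
  assumes "s * t = r" "i + j = n"
  shows "(\<Sum>k\<le>n. coeff ([:- r, 1:] ^ n) k * (taylor_coeff s j (monom 1 k) * taylor_coeff t i (monom 1 k)))
     = of_nat (n choose i) * s ^ i * t ^ j"
proof -
  have "[:0, t:] = monom t 1" by (simp add: monom_Suc monom_0)
  then have "[:0, t:] ^ j = monom (t ^ j) j" by (simp add: monom_power)
  then have "coeff ([:[:0, t:], [:s, 1:]:] ^ n) i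
      = of_nat (n choose i) * (monom (t ^ j) j * [:s, 1:] ^ i)"
    using assms(2) by (subst coeff_linear_poly_power) (auto simp: mult_ac)
  then show ?thesis
    using assms(1) by (simp add: taylor_pairing of_nat_poly coeff_monom_mult coeff_0_power)
qed

text \<open>The hypothesis states that \<open>(u v - r)\<^sup>n\<close> lies in the ideal \<open>(g(u), h(v))\<close> of
  \<open>\<complex>[u, v]\<close>, phrased by functionals so that no ideal in two variables occurs. The zero set
  of that ideal is the product of the two root sets and must lie on the hyperbola
  \<open>u v = r\<close>, which contains no such product with more than one point.\<close>

lemma paired_ideals_power_of_linear:
  fixes g h :: "complex poly" and r :: complex
  assumes r: "r \<noteq> 0" and n: "n > 0" and g: "\<not> is_unit g" and h: "\<not> is_unit h"
    and pairing: "\<And>D E. Vector_Spaces.linear smult (*) D \<Longrightarrow> Vector_Spaces.linear smult (*) E \<Longrightarrow>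
      (\<And>f. g dvd f \<Longrightarrow> D f = 0) \<Longrightarrow> (\<And>f. h dvd f \<Longrightarrow> E f = 0) \<Longrightarrow>
      (\<Sum>k\<le>n. coeff ([:- r, 1:] ^ n) k * (D (monom 1 k) * E (monom 1 k))) = 0"
  obtains s t l m where "s * t = r" "l > 0" "m > 0" "l + m \<le> n + 1"
    "g dvd [:- s, 1:] ^ l" "h dvd [:- t, 1:] ^ m"
proof -
  have pair0: "(\<Sum>k\<le>n. coeff ([:- r, 1:] ^ n) k
      * (taylor_coeff s j (monom 1 k) * taylor_coeff t i (monom 1 k))) = 0"
    if "[:- s, 1:] ^ l dvd g" "[:- t, 1:] ^ m dvd h" "j < l" "i < m" for s t l m i j
  proof (intro pairing taylor_coeff_linear)
    show "taylor_coeff s j f = 0" if "g dvd f" for f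
      using that \<open>[:- s, 1:] ^ l dvd g\<close> \<open>j < l\<close> by (meson dvd_trans taylor_coeff_eq_0)
    show "taylor_coeff t i f = 0" if "h dvd f" for f
      using that \<open>[:- t, 1:] ^ m dvd h\<close> \<open>i < m\<close> by (meson dvd_trans taylor_coeff_eq_0)
  qed
  have roots: "s * t = r" if "poly g s = 0" "poly h t = 0" for s t
  proof -
    have "(s * t - r) ^ n = 0"
      using pair0[of s 1 t 1 0 0] that by (simp add: taylor_pairing_bottom poly_eq_0_iff_dvd)
    then show ?thesis by simp
  qed
  have ex_root: "\<exists>z. poly f z = 0" if "\<not> is_unit f" for f :: "complex poly"
    using that by (intro fundamental_theorem_of_algebra_alt) (auto simp: is_unit_const_poly_iff dvd_field_iff)
  have power_of_linear: "\<exists>l>0. [:- z, 1:] ^ l dvd f \<and> f dvd [:- z, 1:] ^ l"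
    if z: "poly f z = 0" and unique: "\<And>z'. poly f z' = 0 \<Longrightarrow> z' = z" for f :: "complex poly" and z
  proof -
    \<comment> \<open>The zero polynomial vanishes at \<open>z + 1\<close> as well, contrary to uniqueness.\<close>
    have "f \<noteq> 0" using unique[of "z + 1"] by auto
    then obtain q where q: "f = [:- z, 1:] ^ order z f * q" "\<not> [:- z, 1:] dvd q"
      using order_decomp by blast
    have "poly q z' \<noteq> 0" for z'
    proof
      assume q0: "poly q z' = 0"
      then have "poly f z' = 0" by (subst q(1)) simp
      then have "z' = z" by (rule unique)
      with q0 q(2) show False by (simp add: poly_eq_0_iff_dvd)
    qed
    then have "is_unit q" using ex_root by blast
    then have "f dvd [:- z, 1:] ^ order z f"
      by (metis q(1) dvd_refl mult_unit_dvd_iff)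
    moreover have "order z f > 0" using z \<open>f \<noteq> 0\<close> by (simp add: order_root)
    ultimately show ?thesis using order_1[of z f] by blast
  qed
  obtain s t where st: "poly g s = 0" "poly h t = 0" using ex_root g h by blast
  have rst: "s * t = r" using roots st by blast
  then have nz: "s \<noteq> 0" "t \<noteq> 0" using r by auto
  have "z = s" if "poly g z = 0" for z
    using roots[OF that st(2)] rst nz by (metis mult_right_cancel)
  then obtain l where l: "l > 0" "[:- s, 1:] ^ l dvd g" "g dvd [:- s, 1:] ^ l"
    using power_of_linear[OF st(1)] by blast
  have "z = t" if "poly h z = 0" for z
    using roots[OF st(1) that] rst nz by (metis mult_left_cancel)
  then obtain m where m: "m > 0" "[:- t, 1:] ^ m dvd h" "h dvd [:- t, 1:] ^ m"
    using power_of_linear[OF st(2)] by blast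
  have "l + m \<le> n + 1"
  proof (rule ccontr)
    assume "\<not> l + m \<le> n + 1"
    \<comment> \<open>The box \<open>j < l\<close>, \<open>i < m\<close> then meets the diagonal \<open>i + j = n\<close>.\<close>
    define j where "j = min (l - 1) n"
    define i where "i = n - j"
    have ij: "j < l" "i < m" "i + j = n"
      using \<open>\<not> l + m \<le> n + 1\<close> l(1) m(1) by (auto simp: i_def j_def)
    have "of_nat (n choose i) * s ^ i * t ^ j = 0"
      using pair0[OF l(2) m(2) ij(1,2)] taylor_pairing_top[OF rst ij(3)] by simp
    moreover have "n choose i \<noteq> 0" using ij(3) by simp
    ultimately show False using nz by simp
  qed
  then show ?thesis using that rst l m by blast
qed

section \<open>Splitting of binomials\<close>

lemma hom_value_monom:
  "k \<le> n \<Longrightarrow> hom_value S T \<alpha> \<beta> \<gamma> n (monom 1 k) = S ^ (\<alpha> * k) * T ^ (\<beta> * k + \<gamma> * (n - k))"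
  by (simp add: hom_value_def if_distrib[of "\<lambda>z. z *\<^sub>C _"] scaleC_one cong: if_cong)

lemma hom_value_pure_tensor:
  "hom_value (S1 \<otimes>\<^sub>C S2) (T1 \<otimes>\<^sub>C T2) \<alpha> \<beta> \<gamma> n f
     = (\<Sum>k\<le>n. coeff f k *\<^sub>C
         (hom_value S1 T1 \<alpha> \<beta> \<gamma> n (monom 1 k) \<otimes>\<^sub>C hom_value S2 T2 \<alpha> \<beta> \<gamma> n (monom 1 k)))"
  unfolding hom_value_def[of "S1 \<otimes>\<^sub>C S2"]
  by (intro sum.cong refl) (simp add: hom_value_monom pure_tensor_power pure_tensor_mult)

text \<open>The restriction to \<open>k \<le> n\<close> reflects that the kernel of \<open>hom_value\<close> in degree \<open>n\<close> is
  only the part of the ideal of degree at most \<open>n\<close>.\<close>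

lemma functional_on_relation_quotient:
  fixes S T :: "'a :: complex_algebra_1"
  assumes T: "right_invertible (T ^ \<gamma>)" and D: "Vector_Spaces.linear smult (*) D"
    and null: "\<And>f. f \<in> relation_ideal S T \<alpha> \<beta> \<gamma> \<Longrightarrow> D f = 0"
  obtains \<phi> where "Vector_Spaces.linear scaleC (*) \<phi>"
    "\<And>k. k \<le> n \<Longrightarrow> \<phi> (hom_value S T \<alpha> \<beta> \<gamma> n (monom 1 k)) = D (monom 1 k)"
proof -
  have "cpoly.subspace {f. degree f \<le> n}"
    by (auto simp: cpoly.subspace_def intro: degree_add_le order_trans[OF degree_smult_le])
  moreover have "D f = 0" if "f \<in> {f. degree f \<le> n}" "hom_value S T \<alpha> \<beta> \<gamma> n f = 0" for f
    using that null by (simp add: hom_value_eq_0_iff[OF T])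
  ultimately obtain \<phi> where \<phi>: "Vector_Spaces.linear scaleC (*) \<phi>"
      "\<And>f. f \<in> {f. degree f \<le> n} \<Longrightarrow> \<phi> (hom_value S T \<alpha> \<beta> \<gamma> n f) = D f"
    by (rule functional_factors_through[OF hom_value_linear D]) blast+
  have "\<phi> (hom_value S T \<alpha> \<beta> \<gamma> n (monom 1 k)) = D (monom 1 k)" if "k \<le> n" for k
    using that by (intro \<phi>(2)) (simp add: degree_monom_eq)
  with \<phi>(1) show ?thesis by (rule that)
qed

text \<open>The product of functionals turns the relation in the tensor product into the pairing
  hypothesis for the generators of the two relation ideals.\<close>

lemma tensor_relation_splits:
  fixes S1 T1 :: "'a :: complex_algebra_1" and S2 T2 :: "'b :: complex_algebra_1"
  assumes r: "r \<noteq> 0" and n: "n > 0"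
    and T: "right_invertible (T1 ^ \<gamma>)" "right_invertible (T2 ^ \<gamma>)"
    and one: "(1 :: 'a) \<noteq> 0" "(1 :: 'b) \<noteq> 0"
    and zero: "hom_value (S1 \<otimes>\<^sub>C S2) (T1 \<otimes>\<^sub>C T2) \<alpha> \<beta> \<gamma> n ([:- r, 1:] ^ n) = 0"
  obtains s t l m where "s * t = r" "l > 0" "m > 0" "l + m \<le> n + 1"
    "[:- s, 1:] ^ l \<in> relation_ideal S1 T1 \<alpha> \<beta> \<gamma>" "[:- t, 1:] ^ m \<in> relation_ideal S2 T2 \<alpha> \<beta> \<gamma>"
proof -
  obtain g where g: "\<And>f. f \<in> relation_ideal S1 T1 \<alpha> \<beta> \<gamma> \<longleftrightarrow> g dvd f" "\<not> is_unit g"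
    by (rule relation_ideal_generator[OF T(1) one(1)]) blast
  obtain h where h: "\<And>f. f \<in> relation_ideal S2 T2 \<alpha> \<beta> \<gamma> \<longleftrightarrow> h dvd f" "\<not> is_unit h"
    by (rule relation_ideal_generator[OF T(2) one(2)]) blast
  have "(\<Sum>k\<le>n. coeff ([:- r, 1:] ^ n) k * (D (monom 1 k) * E (monom 1 k))) = 0"
    if D: "Vector_Spaces.linear smult (*) D" and E: "Vector_Spaces.linear smult (*) E"
      and Dg: "\<And>f. g dvd f \<Longrightarrow> D f = 0" and Eh: "\<And>f. h dvd f \<Longrightarrow> E f = 0" for D E
  proof -
    obtain \<phi> where \<phi>: "Vector_Spaces.linear scaleC (*) \<phi>"
        "\<And>k. k \<le> n \<Longrightarrow> \<phi> (hom_value S1 T1 \<alpha> \<beta> \<gamma> n (monom 1 k)) = D (monom 1 k)"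
      by (rule functional_on_relation_quotient[OF T(1) D, where S = S1 and \<alpha> = \<alpha> and \<beta> = \<beta>])
         (auto simp: g Dg)
    obtain \<psi> where \<psi>: "Vector_Spaces.linear scaleC (*) \<psi>"
        "\<And>k. k \<le> n \<Longrightarrow> \<psi> (hom_value S2 T2 \<alpha> \<beta> \<gamma> n (monom 1 k)) = E (monom 1 k)"
      by (rule functional_on_relation_quotient[OF T(2) E, where S = S2 and \<alpha> = \<alpha> and \<beta> = \<beta>])
         (auto simp: h Eh)
    have "0 = tensor_functional \<phi> \<psi> (hom_value (S1 \<otimes>\<^sub>C S2) (T1 \<otimes>\<^sub>C T2) \<alpha> \<beta> \<gamma> n ([:- r, 1:] ^ n))"
      by (simp add: zero tensor_functional_zero)
    also have "\<dots> = (\<Sum>k\<le>n. coeff ([:- r, 1:] ^ n) k * (D (monom 1 k) * E (monom 1 k)))"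
      unfolding hom_value_pure_tensor tensor_functional_sum
      by (intro sum.cong refl)
         (simp add: tensor_functional_scaleC tensor_functional_pure[OF \<phi>(1) \<psi>(1)] \<phi>(2) \<psi>(2))
    finally show ?thesis by simp
  qed
  note pairing = this
  show ?thesis
  proof (rule paired_ideals_power_of_linear[OF r n g(2) h(2) pairing])
    fix s t l m
    assume "s * t = r" "l > 0" "m > 0" "l + m \<le> n + 1" "g dvd [:- s, 1:] ^ l" "h dvd [:- t, 1:] ^ m"
    then show thesis by (intro that[of s t l m]) (simp_all only: g h)
  qed
qed

lemma scale_xy_binomial:
  "scale_xy a b (const2 c * var_x ^ \<alpha> * var_y ^ \<beta> + const2 d * var_y ^ \<gamma>)
     = const2 (c * a ^ \<alpha> * b ^ \<beta>) * var_x ^ \<alpha> * var_y ^ \<beta> + const2 (d * b ^ \<gamma>) * var_y ^ \<gamma>"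
proof -
  have y: "const2 e * var_y ^ \<gamma> = monom (monom e 0) \<gamma>" for e
    using monomial_conv_monom[of e 0 \<gamma>] by simp
  show ?thesis
    unfolding monomial_conv_monom y by (intro poly_eqI) (simp add: coeff_scale_xy algebra_simps)
qed

text \<open>The condition on \<open>a, b\<close> says that the one-variable polynomial belonging to the scaled
  binomial is a multiple of \<open>u - s\<close>.\<close>

lemma scaled_binomial_power_vanishes:
  assumes T: "right_invertible (T ^ \<gamma>)"
    and mem: "[:- s, 1:] ^ l \<in> relation_ideal S T \<alpha> \<beta> \<gamma>" and l': "l \<le> l'"
    and ab: "c * (s * a ^ \<alpha> * b ^ \<beta>) = - d * b ^ \<gamma>"
  shows "nc_eval S T (\<Phi> (scale_xy a b
           (const2 c * var_x ^ \<alpha> * var_y ^ \<beta> + const2 d * var_y ^ \<gamma>) ^ l')) = 0"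
proof -
  define e where "e = c * a ^ \<alpha> * b ^ \<beta>"
  have "[:d * b ^ \<gamma>, e:] = smult e [:- s, 1:]"
    using ab by (simp add: e_def algebra_simps)
  then have "[:d * b ^ \<gamma>, e:] ^ l' = smult (e ^ l') ([:- s, 1:] ^ l')"
    by (simp only: smult_power)
  moreover have "[:- s, 1:] ^ l' \<in> relation_ideal S T \<alpha> \<beta> \<gamma>"
    using relation_ideal_mult[OF T mem, of "[:- s, 1:] ^ (l' - l)"] l' by (simp flip: power_add)
  then have "hom_value S T \<alpha> \<beta> \<gamma> l' ([:- s, 1:] ^ l') = 0"
    by (subst hom_value_eq_0_iff[OF T]) (simp_all add: degree_linear_power)
  ultimately show ?thesis
    by (simp add: scale_xy_binomial nc_eval_Phi_binomial_power hom_value_smult flip: e_def)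
qed

lemma binomial_splitting:
  fixes S1 T1 :: "'a :: complex_algebra_1" and S2 T2 :: "'b :: complex_algebra_1"
  assumes p: "p = const2 c * var_x ^ \<alpha> * var_y ^ \<beta> + const2 d * var_y ^ \<gamma>"
    and cd: "c \<noteq> 0" "d \<noteq> 0" and n: "n > 0"
    and T: "right_invertible (T1 ^ \<gamma>)" "right_invertible (T2 ^ \<gamma>)"
    and one: "(1 :: 'a) \<noteq> 0" "(1 :: 'b) \<noteq> 0"
    and zero: "nc_eval (S1 \<otimes>\<^sub>C S2) (T1 \<otimes>\<^sub>C T2) (\<Phi> (p ^ n)) = 0"
  obtains s t l m where "s * t = - d / c" "l > 0" "m > 0" "l + m \<le> n + 1"
    "\<And>a b l'. c * (s * a ^ \<alpha> * b ^ \<beta>) = - d * b ^ \<gamma> \<Longrightarrow> l \<le> l' \<Longrightarrow>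
       nc_eval S1 T1 (\<Phi> (scale_xy a b p ^ l')) = 0"
    "\<And>a b m'. c * (t * a ^ \<alpha> * b ^ \<beta>) = - d * b ^ \<gamma> \<Longrightarrow> m \<le> m' \<Longrightarrow>
       nc_eval S2 T2 (\<Phi> (scale_xy a b p ^ m')) = 0"
proof -
  let ?r = "- d / c"
  have "[:d, c:] = smult c [:- ?r, 1:]" using cd by simp
  then have "[:d, c:] ^ n = smult (c ^ n) ([:- ?r, 1:] ^ n)" by (simp only: smult_power)
  then have "c ^ n *\<^sub>C hom_value (S1 \<otimes>\<^sub>C S2) (T1 \<otimes>\<^sub>C T2) \<alpha> \<beta> \<gamma> n ([:- ?r, 1:] ^ n) = 0"
    using zero by (simp only: p nc_eval_Phi_binomial_power hom_value_smult)
  then have "hom_value (S1 \<otimes>\<^sub>C S2) (T1 \<otimes>\<^sub>C T2) \<alpha> \<beta> \<gamma> n ([:- ?r, 1:] ^ n) = 0"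
    using cd by (simp only: alg.scale_eq_0_iff power_eq_0_iff) simp
  moreover have "?r \<noteq> 0" using cd by simp
  ultimately obtain s t l m where st: "s * t = ?r" "l > 0" "m > 0" "l + m \<le> n + 1"
      "[:- s, 1:] ^ l \<in> relation_ideal S1 T1 \<alpha> \<beta> \<gamma>" "[:- t, 1:] ^ m \<in> relation_ideal S2 T2 \<alpha> \<beta> \<gamma>"
    by - (erule tensor_relation_splits[OF _ n T one, rotated])
  show ?thesis
  proof (rule that[OF st(1-4)])
    show "nc_eval S1 T1 (\<Phi> (scale_xy a b p ^ l')) = 0"
      if "c * (s * a ^ \<alpha> * b ^ \<beta>) = - d * b ^ \<gamma>" "l \<le> l'" for a b l'
      unfolding p by (rule scaled_binomial_power_vanishes[OF T(1) st(5) that(2,1)])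
    show "nc_eval S2 T2 (\<Phi> (scale_xy a b p ^ m')) = 0"
      if "c * (t * a ^ \<alpha> * b ^ \<beta>) = - d * b ^ \<gamma>" "m \<le> m'" for a b m'
      unfolding p by (rule scaled_binomial_power_vanishes[OF T(2) st(6) that(2,1)])
  qed
qed

lemma mult_power_inverse: "T * R = 1 \<Longrightarrow> T ^ k * R ^ k = 1" for T R :: "'a :: monoid_mult"
proof (induction k)
  case (Suc k)
  have "T ^ Suc k * R ^ Suc k = T ^ k * (T * R) * R ^ k"
    by (simp only: power_Suc2[of T] power_Suc[of R] mult.assoc)
  then show ?case using Suc by simp
qed simp

text \<open>Multiplying by the one-sided inverses of \<open>S\<^sub>1 \<otimes> S\<^sub>2\<close> on the left and of \<open>T\<^sub>1 \<otimes> T\<^sub>2\<close> on the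
  right turns a monomial in them into \<open>1 \<otimes> 1\<close>. This excludes \<open>B = 0\<close> from the explicit
  part of the theorem.\<close>

lemma monomial_power_nonzero:
  fixes S1 T1 :: "'a :: complex_algebra_1" and S2 T2 :: "'b :: complex_algebra_1"
  assumes "left_invertible S1" "right_invertible T1" "left_invertible S2" "right_invertible T2"
    and one: "(1 :: 'a) \<noteq> 0" "(1 :: 'b) \<noteq> 0" and c: "c \<noteq> 0"
  shows "nc_eval (S1 \<otimes>\<^sub>C S2) (T1 \<otimes>\<^sub>C T2) (\<Phi> ((const2 c * var_x ^ i * var_y ^ j) ^ n)) \<noteq> 0"
proof
  let ?S = "S1 \<otimes>\<^sub>C S2" and ?T = "T1 \<otimes>\<^sub>C T2"
  obtain L1 L2 R1 R2 where inv: "L1 * S1 = 1" "L2 * S2 = 1" "T1 * R1 = 1" "T2 * R2 = 1"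
    using assms by (auto simp: left_invertible_def right_invertible_def)
  let ?L = "L1 \<otimes>\<^sub>C L2" and ?R = "R1 \<otimes>\<^sub>C R2"
  have LS: "?L * ?S = 1" and TR: "?T * ?R = 1"
    by (simp_all add: inv pure_tensor_mult one_tensor_eq)
  assume "nc_eval ?S ?T (\<Phi> ((const2 c * var_x ^ i * var_y ^ j) ^ n)) = 0"
  moreover have "(const2 c * var_x ^ i * var_y ^ j) ^ n
      = const2 (c ^ n) * var_x ^ (i * n) * var_y ^ (j * n)"
    by (simp add: monomial_conv_monom monom_power)
  ultimately have "c ^ n *\<^sub>C (?S ^ (i * n) * ?T ^ (j * n)) = 0"
    by (simp only: nc_eval_Phi_monomial)
  then have "?S ^ (i * n) * ?T ^ (j * n) = 0"
    using c by (simp only: alg.scale_eq_0_iff power_eq_0_iff) simp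
  moreover have "(?L ^ (i * n) * ?S ^ (i * n)) * (?T ^ (j * n) * ?R ^ (j * n)) = 1"
    by (simp only: mult_power_inverse[OF LS] mult_power_inverse[OF TR] mult_1)
  then have "?L ^ (i * n) * (?S ^ (i * n) * ?T ^ (j * n)) * ?R ^ (j * n) = 1"
    by (simp only: mult.assoc)
  ultimately have "(1 :: ('a, 'b) tensor) = 0" by simp
  then show False using one_tensor_one_nonzero[OF one] by (simp add: one_tensor_eq)
qed


section \<open>Quasi-homogeneous irreducible polynomials\<close>

lemma scale_xy_zero_zero:
  assumes "coeff (coeff p 0) 0 = 0"
  shows "scale_xy 0 0 p = 0"
  by (intro poly_eqI) (use assms in \<open>auto simp: coeff_scale_xy power_0_left\<close>)

lemma complex_root_exists:
  assumes "n > 0"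
  shows "\<exists>z :: complex. z ^ n = w"
proof (cases "w = 0")
  case True
  then show ?thesis using assms by (intro exI[of _ 0]) simp
next
  case False
  then have "card {z :: complex. z ^ n = w} = n" using assms by (intro card_nth_roots)
  then have "{z :: complex. z ^ n = w} \<noteq> {}" using assms by (metis card.empty less_irrefl)
  then show ?thesis by blast
qed

lemma monomial_value_exists:
  assumes "(\<alpha>, \<beta>) \<noteq> (0 :: nat, 0 :: nat)"
  shows "\<exists>a b :: complex. a ^ \<alpha> * b ^ \<beta> = w"
proof (cases "\<beta> = 0")
  case True
  then show ?thesis using complex_root_exists[of \<alpha> w] assms by auto
next
  case False
  then obtain b where "b ^ \<beta> = w" using complex_root_exists[of \<beta> w] by auto
  then show ?thesis by (intro exI[of _ 1] exI[of _ b]) simp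
qed

text \<open>The lattice points of a line through the origin are the multiples of a primitive one. Only
  points of the first quadrant matter, so the signs of the weights can be dropped.\<close>

lemma weight_zero_support:
  fixes w1 w2 :: int and i j :: nat
  assumes "coprime w1 w2" "w1 * int i + w2 * int j = 0"
  shows "\<exists>k. i = nat \<bar>w2\<bar> * k \<and> j = nat \<bar>w1\<bar> * k"
proof -
  define \<alpha> \<beta> where "\<alpha> = nat \<bar>w2\<bar>" and "\<beta> = nat \<bar>w1\<bar>"
  have cop: "coprime \<beta> \<alpha>"
    using assms(1) by (simp add: \<alpha>_def \<beta>_def flip: coprime_int_iff)
  have "\<bar>w1\<bar> * int i = \<bar>w2\<bar> * int j"
    using assms(2) by (metis abs_minus_cancel abs_mult abs_of_nat add_eq_0_iff)
  then have "int (\<beta> * i) = int (\<alpha> * j)"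
    by (simp add: \<alpha>_def \<beta>_def)
  then have eq: "\<beta> * i = \<alpha> * j" by (simp only: of_nat_eq_iff)
  have "\<exists>k. i = \<alpha> * k \<and> j = \<beta> * k"
  proof (cases "\<beta> = 0")
    case True
    with cop eq show ?thesis by simp
  next
    case False
    have "\<beta> dvd j" using cop eq by (metis coprime_dvd_mult_right_iff dvd_triv_left)
    then obtain k where "j = \<beta> * k" by (auto simp: dvd_def)
    with eq False show ?thesis by (intro exI[of _ k]) simp
  qed
  then show ?thesis by (simp add: \<alpha>_def \<beta>_def)
qed

lemma is_unit_poly2_iff: "is_unit q \<longleftrightarrow> (\<exists>e. e \<noteq> 0 \<and> q = const2 e)"
  by (auto simp: is_unit_poly_iff const2_def dvd_field_iff)

text \<open>The constant term puts the origin on the line of exponents, so \<open>p\<close> is a polynomial \<open>f\<close> in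
  the single monomial \<open>M = x\<^sup>\<alpha> y\<^sup>\<beta>\<close>. If \<open>z\<close> is a root of \<open>f\<close>, then
  \<open>M - z\<close> divides \<open>f(M) - f(z) = p\<close> and irreducibility leaves only a constant cofactor.\<close>

lemma irreducible_quasi_homogeneous_nonzero_at_origin:
  assumes irr: "irreducible p" and qh: "quasi_homogeneous p" and p0: "coeff (coeff p 0) 0 \<noteq> 0"
  obtains \<alpha> \<beta> c d where "(\<alpha>, \<beta>) \<noteq> (0, 0)" "c \<noteq> 0" "d \<noteq> 0"
    "p = const2 c * var_x ^ \<alpha> * var_y ^ \<beta> + const2 d * var_y ^ 0"
proof -
  obtain w1 w2 w :: int where cop: "coprime w1 w2"
      and wt: "\<And>i j. coeff (coeff p j) i \<noteq> 0 \<Longrightarrow> w1 * int i + w2 * int j = w"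
    using qh by (auto simp: quasi_homogeneous_def)
  have "w = 0" using wt[of 0 0] p0 by simp
  define \<alpha> \<beta> where "\<alpha> = nat \<bar>w2\<bar>" and "\<beta> = nat \<bar>w1\<bar>"
  have nz: "\<alpha> \<noteq> 0 \<or> \<beta> \<noteq> 0" using cop by (auto simp: \<alpha>_def \<beta>_def)
  have supp: "\<exists>k. i = \<alpha> * k \<and> j = \<beta> * k" if "coeff (coeff p j) i \<noteq> 0" for i j
    using weight_zero_support[OF cop, of i j] wt[OF that] \<open>w = 0\<close> by (simp add: \<alpha>_def \<beta>_def)
  define M where "M = var_x ^ \<alpha> * var_y ^ \<beta>"
  define c where "c k = coeff (coeff p (\<beta> * k)) (\<alpha> * k)" for k
  obtain I where I: "degree (coeff p j) \<le> I" for j using inner_degree_bounded[of p] by blast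
  define N where "N = I + degree p"
  have c_bound: "k \<le> N" if "c k \<noteq> 0" for k
  proof -
    have "\<beta> * k \<le> degree p" "\<alpha> * k \<le> degree (coeff p (\<beta> * k))"
      using that by (auto simp: c_def intro!: le_degree)
    then have "\<alpha> * k + \<beta> * k \<le> N" using I[of "\<beta> * k"] by (simp add: N_def)
    moreover have "k \<le> \<alpha> * k + \<beta> * k" using nz by (cases \<alpha>; cases \<beta>) auto
    ultimately show ?thesis by simp
  qed
  have monom_eq: "const2 e * M ^ k = monom (monom e (\<alpha> * k)) (\<beta> * k)" for e k
    by (simp add: M_def power_mult_distrib power_mult monomial_conv_monom
        flip: mult.assoc power_mult)
  have p_sum: "p = (\<Sum>k\<le>N. const2 (c k) * M ^ k)"
  proof (intro poly_eqI)
    fix j i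
    have "coeff (coeff (\<Sum>k\<le>N. const2 (c k) * M ^ k) j) i
        = (\<Sum>k\<le>N. if i = \<alpha> * k \<and> j = \<beta> * k then c k else 0)"
      unfolding coeff_sum by (intro sum.cong refl) (auto simp: monom_eq)
    also have "\<dots> = coeff (coeff p j) i"
    proof (cases "\<exists>k. i = \<alpha> * k \<and> j = \<beta> * k")
      case True
      then obtain k where k: "i = \<alpha> * k" "j = \<beta> * k" by blast
      have "(i = \<alpha> * k' \<and> j = \<beta> * k') \<longleftrightarrow> k' = k" for k'
        using nz k by auto
      then have "(\<Sum>k\<le>N. if i = \<alpha> * k \<and> j = \<beta> * k then c k else 0) = (if k \<le> N then c k else 0)"
        by simp
      then show ?thesis using c_bound[of k] by (auto simp: c_def k)
    next
      case False
      then have "coeff (coeff p j) i = 0" using supp by blast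
      with False show ?thesis by (intro trans[OF sum.neutral]) auto
    qed
    finally show "coeff (coeff p j) i = coeff (coeff (\<Sum>k\<le>N. const2 (c k) * M ^ k) j) i" ..
  qed
  define f where "f = (\<Sum>k\<le>N. monom (c k) k)"
  have poly_f: "poly f z = (\<Sum>k\<le>N. c k * z ^ k)" for z
    by (simp add: f_def poly_sum poly_monom)
  have "\<exists>z. poly f z = 0"
  proof (rule fundamental_theorem_of_algebra_alt, clarify)
    fix a l assume "a \<noteq> 0" and f: "f = [:a:]"
    have "c k = coeff f k" if "k \<le> N" for k using that by (simp add: f_def coeff_sum)
    then have "const2 (c k) * M ^ k = (if k = 0 then const2 a else 0)" if "k \<le> N" for k
      using that by (cases k) (simp_all add: f const2_def)
    then have "p = const2 a" by (subst p_sum) simp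
    then have "is_unit p" using \<open>a \<noteq> 0\<close> by (auto simp: is_unit_poly2_iff)
    then show False using irr by (simp add: irreducible_not_unit)
  qed
  then obtain z where z: "poly f z = 0" by blast
  have "p = p - const2 (poly f z)" by (simp add: z const2_def)
  also have "\<dots> = (\<Sum>k\<le>N. const2 (c k) * (M ^ k - const2 z ^ k))"
    by (subst p_sum)
       (simp add: poly_f const2_sum const2_mult const2_power sum_subtractf right_diff_distrib)
  also have "M - const2 z dvd \<dots>"
    by (intro dvd_sum dvd_mult) (simp add: power_diff_sumr2)
  finally obtain q where q: "p = (M - const2 z) * q" by (auto simp: dvd_def)
  have M: "M = monom (monom 1 \<alpha>) \<beta>"
    using monom_eq[of 1 1] by (simp add: const2_def flip: one_pCons)
  have "\<not> is_unit (M - const2 z)"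
  proof
    assume "is_unit (M - const2 z)"
    then obtain e where "M - const2 z = const2 e" by (auto simp: is_unit_poly2_iff)
    then have "coeff (coeff (M - const2 z) \<beta>) \<alpha> = coeff (coeff (const2 e) \<beta>) \<alpha>" by simp
    then show False using nz by (auto simp: M const2_def coeff_pCons split: nat.splits)
  qed
  then have "is_unit q" using irreducibleD[OF irr q] by blast
  then obtain e where e: "e \<noteq> 0" "q = const2 e" by (auto simp: is_unit_poly2_iff)
  have p_eq: "p = const2 e * var_x ^ \<alpha> * var_y ^ \<beta> + const2 (- e * z) * var_y ^ 0"
    by (simp add: q e M_def const2_def algebra_simps)
  have "z \<noteq> 0"
  proof
    assume "z = 0"
    then have "p = monom (monom e \<alpha>) \<beta>"
      using p_eq by (simp add: monomial_conv_monom) (simp add: const2_def)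
    then show False using p0 nz by (auto split: if_splits)
  qed
  then show ?thesis by (intro that[OF _ e(1) _ p_eq]) (use nz e in auto)
qed


section \<open>The splitting theorem\<close>

lemma one_nonzero_if_nonzero:
  fixes S T :: "'a :: complex_algebra_1"
  assumes "\<not> (S = 0 \<and> T = 0)"
  shows "(1 :: 'a) \<noteq> 0"
  using assms by (metis mult_1_right mult_zero_right)

lemma right_invertible_power: "right_invertible T \<Longrightarrow> right_invertible (T ^ k)"
  unfolding right_invertible_def using mult_power_inverse by blast

lemma splitting_zero_at_origin:
  assumes p0: "coeff (coeff p 0) 0 = 0" and "l > 0"
  shows "nc_eval S T (\<Phi> (scale_xy 0 0 p ^ l)) = 0"
  using assms by (simp add: scale_xy_zero_zero nc_eval_Phi_zero power_0_left)

text \<open>Here \<open>\<gamma> = 0\<close>, so that \<open>T\<^sup>\<gamma> = 1\<close> and the relation ideals are available for every pair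
  \<open>S, T\<close>. As \<open>s\<close> and \<open>t\<close> are nonzero, suitable values of \<open>a\<^sup>\<alpha> b\<^sup>\<beta>\<close> move the root of the
  binomial to them.\<close>

lemma splitting_nonzero_at_origin:
  fixes S1 T1 :: "'a :: complex_algebra_1" and S2 T2 :: "'b :: complex_algebra_1"
  assumes irr: "irreducible p" and qh: "quasi_homogeneous p" and p0: "coeff (coeff p 0) 0 \<noteq> 0"
    and n: "n > 0" and one: "(1 :: 'a) \<noteq> 0" "(1 :: 'b) \<noteq> 0"
    and zero: "nc_eval (S1 \<otimes>\<^sub>C S2) (T1 \<otimes>\<^sub>C T2) (\<Phi> (p ^ n)) = 0"
  obtains a b c d l m where "l > 0" "m > 0" "l + m \<le> n + 1"
    "\<And>l'. l \<le> l' \<Longrightarrow> nc_eval S1 T1 (\<Phi> (scale_xy a b p ^ l')) = 0"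
    "\<And>m'. m \<le> m' \<Longrightarrow> nc_eval S2 T2 (\<Phi> (scale_xy c d p ^ m')) = 0"
proof -
  obtain \<alpha> \<beta> e f where nz: "(\<alpha>, \<beta>) \<noteq> (0, 0)" and ef: "e \<noteq> 0" "f \<noteq> 0"
      and p: "p = const2 e * var_x ^ \<alpha> * var_y ^ \<beta> + const2 f * var_y ^ 0"
    by (rule irreducible_quasi_homogeneous_nonzero_at_origin[OF irr qh p0])
  have "right_invertible (T1 ^ 0)" "right_invertible (T2 ^ 0)"
    by (auto simp: right_invertible_def)
  from binomial_splitting[OF p ef n this one zero]
  obtain s t l m where st: "s * t = - f / e" "l > 0" "m > 0" "l + m \<le> n + 1"
    and l: "\<And>a b l'. e * (s * a ^ \<alpha> * b ^ \<beta>) = - f * b ^ 0 \<Longrightarrow> l \<le> l' \<Longrightarrow>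
       nc_eval S1 T1 (\<Phi> (scale_xy a b p ^ l')) = 0"
    and m: "\<And>a b m'. e * (t * a ^ \<alpha> * b ^ \<beta>) = - f * b ^ 0 \<Longrightarrow> m \<le> m' \<Longrightarrow>
       nc_eval S2 T2 (\<Phi> (scale_xy a b p ^ m')) = 0"
    by metis
  have st_nz: "s \<noteq> 0" "t \<noteq> 0" using st(1) ef by auto
  obtain a b where ab: "a ^ \<alpha> * b ^ \<beta> = - f / (e * s)" using monomial_value_exists[OF nz] by blast
  obtain c d where cd: "c ^ \<alpha> * d ^ \<beta> = - f / (e * t)" using monomial_value_exists[OF nz] by blast
  have "e * (s * a ^ \<alpha> * b ^ \<beta>) = - f * b ^ 0" "e * (t * c ^ \<alpha> * d ^ \<beta>) = - f * d ^ 0"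
    using ab cd ef st_nz by (simp_all add: mult.assoc)
  from l[OF this(1)] m[OF this(2)] show ?thesis by (rule that[OF st(2-4)])
qed

lemma irreducible_quasi_homogeneous_strong_tensor_splitting:
  assumes irr: "irreducible p" and qh: "quasi_homogeneous p"
  shows "strong_tensor_splitting TYPE('a :: complex_algebra_1) TYPE('b :: complex_algebra_1) p"
proof -
  have split: "\<exists>a b c d l m. l > 0 \<and> m > 0 \<and> l + m = n + 1 \<and>
      (\<forall>l'\<ge>l. nc_eval S1 T1 (\<Phi> (scale_xy a b p ^ l')) = 0) \<and>
      (\<forall>m'\<ge>m. nc_eval S2 T2 (\<Phi> (scale_xy c d p ^ m')) = 0)"
    if "\<not> (S1 = 0 \<and> T1 = 0)" "\<not> (S2 = 0 \<and> T2 = 0)" "n > 0"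
      "nc_eval (S1 \<otimes>\<^sub>C S2) (T1 \<otimes>\<^sub>C T2) (\<Phi> (p ^ n)) = 0"
    for S1 T1 :: 'a and S2 T2 :: 'b and n
  proof (cases "coeff (coeff p 0) 0 = 0")
    case True
    show ?thesis
      by (rule exI[of _ 0], rule exI[of _ 0], rule exI[of _ 0], rule exI[of _ 0],
          rule exI[of _ n], rule exI[of _ 1])
         (use that(3) in \<open>auto intro!: splitting_zero_at_origin[OF True]\<close>)
  next
    case False
    note hyps = that
    from splitting_nonzero_at_origin[OF irr qh False hyps(3)
            one_nonzero_if_nonzero[OF hyps(1)] one_nonzero_if_nonzero[OF hyps(2)] hyps(4)]
    obtain a b c d l m where *: "l > 0" "m > 0" "l + m \<le> n + 1"
      "\<And>l'. l \<le> l' \<Longrightarrow> nc_eval S1 T1 (\<Phi> (scale_xy a b p ^ l')) = 0"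
      "\<And>m'. m \<le> m' \<Longrightarrow> nc_eval S2 T2 (\<Phi> (scale_xy c d p ^ m')) = 0"
      by metis
    \<comment> \<open>The sum of the exponents may be less than \<open>n + 1\<close>; enlarging the first one repairs
      this, as all larger exponents work too.\<close>
    show ?thesis
      by (rule exI[of _ a], rule exI[of _ b], rule exI[of _ c], rule exI[of _ d],
          rule exI[of _ "n + 1 - m"], rule exI[of _ m])
         (use * in auto)
  qed
  have "weak_tensor_splitting TYPE('a) TYPE('b) p"
    unfolding weak_tensor_splitting_def
  proof (intro allI impI, elim conjE)
    fix S1 T1 :: 'a and S2 T2 :: 'b and n :: nat
    assume "\<not> (S1 = 0 \<and> T1 = 0)" "\<not> (S2 = 0 \<and> T2 = 0)" "n > 0"
      "nc_eval (S1 \<otimes>\<^sub>C S2) (T1 \<otimes>\<^sub>C T2) (\<Phi> (p ^ n)) = 0"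
    from split[OF this]
    show "\<exists>a b c d. (\<exists>N. \<forall>l\<ge>N. nc_eval S1 T1 (\<Phi> (scale_xy a b p ^ l)) = 0) \<and>
        (\<exists>N. \<forall>m\<ge>N. nc_eval S2 T2 (\<Phi> (scale_xy c d p ^ m)) = 0)"
      by blast
  qed
  moreover have "\<exists>a b c d l m. l > 0 \<and> m > 0 \<and> l + m = n + 1 \<and>
      nc_eval S1 T1 (\<Phi> (scale_xy a b p ^ l)) = 0 \<and> nc_eval S2 T2 (\<Phi> (scale_xy c d p ^ m)) = 0"
    if "\<not> (S1 = 0 \<and> T1 = 0)" "\<not> (S2 = 0 \<and> T2 = 0)" "n > 0"
      "nc_eval (S1 \<otimes>\<^sub>C S2) (T1 \<otimes>\<^sub>C T2) (\<Phi> (p ^ n)) = 0"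
    for S1 T1 :: 'a and S2 T2 :: 'b and n
    using split[OF that] by (meson order_refl)
  ultimately show ?thesis
    unfolding strong_tensor_splitting_def by simp
qed

text \<open>The scalar \<open>\<mu>\<close> is a \<open>\<beta>\<close>-th root chosen to move the root of the scaled binomial to \<open>s\<close>.
  Since \<open>s t\<close> is prescribed, scaling by \<open>\<eta> / \<mu>\<close> then moves it to \<open>t\<close>.\<close>

lemma explicit_splitting:
  fixes S1 T1 :: "'a :: complex_algebra_1" and S2 T2 :: "'b :: complex_algebra_1"
  assumes irr: "irreducible p" and \<beta>: "\<beta> > 0"
    and p: "p = const2 A * (var_x ^ \<alpha> * var_y ^ \<beta> - const2 B) \<or>
            p = const2 A * (const2 B * var_x ^ \<alpha> - var_y ^ \<beta>)"
    and \<eta>: "\<eta> ^ \<beta> = B" and n: "n > 0"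
    and one: "(1 :: 'a) \<noteq> 0" "(1 :: 'b) \<noteq> 0"
    and zero: "nc_eval (S1 \<otimes>\<^sub>C S2) (T1 \<otimes>\<^sub>C T2) (\<Phi> (p ^ n)) = 0"
    and inv: "left_invertible S1" "right_invertible T1" "left_invertible S2" "right_invertible T2"
  shows "\<exists>\<mu> l m. \<mu> \<noteq> 0 \<and> l + m \<le> n + 1 \<and> nc_eval S1 T1 (\<Phi> (scale_y \<mu> p ^ l)) = 0 \<and>
           nc_eval S2 T2 (\<Phi> (scale_y (\<eta> / \<mu>) p ^ m)) = 0"
proof -
  have A: "A \<noteq> 0" using irr p by (auto simp: const2_def)
  have "B \<noteq> 0"
  proof
    assume "B = 0"
    with p have "p = const2 A * var_x ^ \<alpha> * var_y ^ \<beta> \<or> p = const2 (- A) * var_x ^ 0 * var_y ^ \<beta>"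
      by (auto simp: const2_uminus const2_0 mult.assoc)
    then show False
      using zero monomial_power_nonzero[OF inv one] A by (metis neg_equal_0_iff_equal)
  qed
  then have "\<eta> \<noteq> 0" using \<eta> \<beta> by auto
  from p show ?thesis
  proof
    assume "p = const2 A * (var_x ^ \<alpha> * var_y ^ \<beta> - const2 B)"
    then have p: "p = const2 A * var_x ^ \<alpha> * var_y ^ \<beta> + const2 (- A * B) * var_y ^ 0"
      by (simp add: const2_mult const2_uminus right_diff_distrib mult.assoc)
    have cd: "A \<noteq> 0" "- A * B \<noteq> 0" using A \<open>B \<noteq> 0\<close> by simp_all
    from binomial_splitting[OF p cd n right_invertible_power[OF inv(2)]
        right_invertible_power[OF inv(4)] one zero]
    obtain s t l m where st: "s * t = - (- A * B) / A" "l + m \<le> n + 1"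
      and l: "\<And>a b l'. A * (s * a ^ \<alpha> * b ^ \<beta>) = - (- A * B) * b ^ 0 \<Longrightarrow> l \<le> l' \<Longrightarrow>
         nc_eval S1 T1 (\<Phi> (scale_xy a b p ^ l')) = 0"
      and m: "\<And>a b m'. A * (t * a ^ \<alpha> * b ^ \<beta>) = - (- A * B) * b ^ 0 \<Longrightarrow> m \<le> m' \<Longrightarrow>
         nc_eval S2 T2 (\<Phi> (scale_xy a b p ^ m')) = 0"
      by metis
    have st_B: "s * t = B" using st(1) A by simp
    then have nz: "s \<noteq> 0" "t \<noteq> 0" using \<open>B \<noteq> 0\<close> by auto
    obtain \<mu> where \<mu>: "\<mu> ^ \<beta> = t" using complex_root_exists[OF \<beta>] by blast
    have "\<mu> \<noteq> 0" using \<mu> nz \<beta> by (auto simp: power_0_left)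
    moreover have "nc_eval S1 T1 (\<Phi> (scale_y \<mu> p ^ l)) = 0"
      unfolding scale_y_def by (rule l) (simp_all add: \<mu> st_B)
    moreover have "nc_eval S2 T2 (\<Phi> (scale_y (\<eta> / \<mu>) p ^ m)) = 0"
      unfolding scale_y_def by (rule m) (simp_all add: power_divide \<mu> \<eta> nz)
    ultimately show ?thesis using st(2) by blast
  next
    assume "p = const2 A * (const2 B * var_x ^ \<alpha> - var_y ^ \<beta>)"
    then have p: "p = const2 (A * B) * var_x ^ \<alpha> * var_y ^ 0 + const2 (- A) * var_y ^ \<beta>"
      by (simp add: const2_mult const2_uminus right_diff_distrib mult.assoc)
    have cd: "A * B \<noteq> 0" "- A \<noteq> 0" using A \<open>B \<noteq> 0\<close> by simp_all
    from binomial_splitting[OF p cd n right_invertible_power[OF inv(2)]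
        right_invertible_power[OF inv(4)] one zero]
    obtain s t l m where st: "s * t = - (- A) / (A * B)" "l + m \<le> n + 1"
      and l: "\<And>a b l'. A * B * (s * a ^ \<alpha> * b ^ 0) = - (- A) * b ^ \<beta> \<Longrightarrow> l \<le> l' \<Longrightarrow>
         nc_eval S1 T1 (\<Phi> (scale_xy a b p ^ l')) = 0"
      and m: "\<And>a b m'. A * B * (t * a ^ \<alpha> * b ^ 0) = - (- A) * b ^ \<beta> \<Longrightarrow> m \<le> m' \<Longrightarrow>
         nc_eval S2 T2 (\<Phi> (scale_xy a b p ^ m')) = 0"
      by metis
    have st_B: "B * s * t = 1" using st(1) A \<open>B \<noteq> 0\<close> by (simp add: field_simps)
    then have nz: "s \<noteq> 0" "t \<noteq> 0" by auto
    obtain \<mu> where \<mu>: "\<mu> ^ \<beta> = B * s" using complex_root_exists[OF \<beta>] by blast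
    have "\<mu> \<noteq> 0" using \<mu> nz \<beta> \<open>B \<noteq> 0\<close> by (auto simp: power_0_left)
    moreover have "nc_eval S1 T1 (\<Phi> (scale_y \<mu> p ^ l)) = 0"
      unfolding scale_y_def by (rule l) (simp_all add: \<mu>)
    moreover have "B * t = (\<eta> / \<mu>) ^ \<beta>"
      using st_B nz \<open>B \<noteq> 0\<close> by (simp add: power_divide \<mu> \<eta> field_simps)
    then have "nc_eval S2 T2 (\<Phi> (scale_y (\<eta> / \<mu>) p ^ m)) = 0"
      unfolding scale_y_def by (intro m) simp_all
    ultimately show ?thesis using st(2) by blast
  qed
qed

theorem theorem4p7:
  shows "(\<forall>p. irreducible p \<and> quasi_homogeneous p \<longrightarrow>
            strong_tensor_splitting TYPE('a :: complex_algebra_1) TYPE('b :: complex_algebra_1) p) \<and>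
         (\<forall>(p :: poly2) (\<alpha> :: nat) (\<beta> :: nat) (A :: complex) (B :: complex) (\<eta> :: complex)
            (S1 :: 'a) (T1 :: 'a) (S2 :: 'b) (T2 :: 'b) (n :: nat).
            irreducible p \<and> \<alpha> > 0 \<and> \<beta> > 0 \<and> coprime \<alpha> \<beta> \<and>
            (p = const2 A * (var_x ^ \<alpha> * var_y ^ \<beta> - const2 B) \<or>
             p = const2 A * (const2 B * var_x ^ \<alpha> - var_y ^ \<beta>)) \<and>
            \<eta> ^ \<beta> = B \<and>
            \<not> (S1 = 0 \<and> T1 = 0) \<and> \<not> (S2 = 0 \<and> T2 = 0) \<and> n > 0 \<and>
            nc_eval (S1 \<otimes>\<^sub>C S2) (T1 \<otimes>\<^sub>C T2) (\<Phi> (p ^ n)) = 0 \<and>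
            left_invertible S1 \<and> right_invertible T1 \<and>
            left_invertible S2 \<and> right_invertible T2 \<longrightarrow>
            (\<exists>(\<mu> :: complex) (l :: nat) (m :: nat). \<mu> \<noteq> 0 \<and> l + m \<le> n + 1 \<and>
               nc_eval S1 T1 (\<Phi> (scale_y \<mu> p ^ l)) = 0 \<and>
               nc_eval S2 T2 (\<Phi> (scale_y (\<eta> / \<mu>) p ^ m)) = 0))"
proof (intro conjI allI impI; elim conjE)
  fix p :: poly2
  assume "irreducible p" "quasi_homogeneous p"
  then show "strong_tensor_splitting TYPE('a) TYPE('b) p"
    by (rule irreducible_quasi_homogeneous_strong_tensor_splitting)
qed (intro explicit_splitting one_nonzero_if_nonzero; assumption)

end
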